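(* Let $\mathsf{M}$ be a $d\times d$ real-valued invertible matrix. Let $\Phi=\{\phi^1,\ldots,\phi^r\}$, $\Psi=\{\psi^1,\ldots,\psi^s\}$, $\tilde\Phi=\{\tilde\phi^1,\ldots,\tilde\phi^r\}$, $\tilde\Psi=\{\tilde\psi^1,\ldots,\tilde\psi^s\}$ be subsets of $L_2(\mathbb{R}^d)$, where $r,s\in\mathbb{N}\cup\{0,+\infty\}$. Suppose that $(\mathsf{WS}_J(\Phi;\Psi),\mathsf{WS}_J(\tilde\Phi;\tilde\Psi))$ is a pair of nonhomogeneous dual $\mathsf{M}$-wavelet frames in $L_2(\mathbb{R}^d)$ for some integer $J$. Then it is a pair of nonhomogeneous dual $\mathsf{M}$-wavelet frames in $L_2(\mathbb{R}^d)$ for all integers $J$. If in addition $\mathsf{M}$ is an expansive matrix and $\sum_{\phi\in\Phi}\|\phi\|^2_{L_2(\mathbb{R}^d)}<\infty$, then $(\mathsf{WS}(\Psi),\mathsf{WS}(\tilde\Psi))$ is a pair of homogeneous dual $\mathsf{M}$-wavelet frames in $L_2(\mathbb{R}^d)$, that is, each of $\mathsf{WS}(\Psi)$ and $\mathsf{WS}(\tilde\Psi)$ is a frame in $L_2(\mathbb{R}^d)$ and $$\langle f,g\rangle=\sum_{j\in\mathbb{Z}}\sum_{\ell=1}^s\sum_{k\in\mathbb{Z}^d}\langle f,\psi^\ell_{\mathsf{M}^j;k}\rangle\langle\tilde\psi^\ell_{\mathsf{M}^j;k},g\rangle,\qquad\forall f,g\in L_2(\mathbb{R}^d).$$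
   Context: For $f:\mathbb{R}^d\to\mathbb{C}$, a $d\times d$ real invertible matrix $U$ and $k\in\mathbb{R}^d$, put $f_{U;k}(x):=|\det U|^{1/2}f(Ux-k)$. For subsets $\Phi,\Psi$ of $L_2(\mathbb{R}^d)$ and $J\in\mathbb{Z}$, $$\mathsf{WS}_J(\Phi;\Psi):=\{\phi_{\mathsf{M}^J;k}: k\in\mathbb{Z}^d,\phi\in\Phi\}\cup\{\psi_{\mathsf{M}^j;k}: j\ge J,\ k\in\mathbb{Z}^d,\psi\in\Psi\},\qquad \mathsf{WS}(\Psi):=\{\psi_{\mathsf{M}^j;k}: j\in\mathbb{Z},k\in\mathbb{Z}^d,\psi\in\Psi\}.$$ Elements of generator sets are not necessarily distinct and are counted with multiplicity (systems are indexed families). A family $\{h_i\}$ in $L_2(\mathbb{R}^d)$ is a frame if there are positive constants $C_1,C_2$ with $C_1\|f\|^2\le\sum_i|\langle f,h_i\rangle|^2\le C_2\|f\|^2$ for all $f\in L_2(\mathbb{R}^d)$. The pair $(\mathsf{WS}_J(\Phi;\Psi),\mathsf{WS}_J(\tilde\Phi;\tilde\Psi))$ is a pair of nonhomogeneous dual $\mathsf{M}$-wavelet frames in $L_2(\mathbb{R}^d)$ if each of the two systems is a frame in $L_2(\mathbb{R}^d)$ and $$\langle f,g\rangle=\sum_{\ell=1}^r\sum_{k\in\mathbb{Z}^d}\langle f,\phi^\ell_{\mathsf{M}^J;k}\rangle\langle\tilde\phi^\ell_{\mathsf{M}^J;k},g\rangle+\sum_{j=J}^\infty\sum_{\ell=1}^s\sum_{k\in\mathbb{Z}^d}\langle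 f,\psi^\ell_{\mathsf{M}^j;k}\rangle\langle\tilde\psi^\ell_{\mathsf{M}^j;k},g\rangle,\qquad\forall f,g\in L_2(\mathbb{R}^d).$$ A matrix is expansive if all its eigenvalues have modulus greater than one. $\langle f,g\rangle=\int_{\mathbb{R}^d}f\overline g$. *)

theory Defs
  imports "HOL-Analysis.Analysis" "HOL-Library.Extended_Nat"
begin

text \<open>Elements of \<open>L\<^sub>2(\<real>\<^sup>d)\<close> are represented by functions, not by classes modulo null sets.\<close>

definition L2 :: "(real ^ 'd \<Rightarrow> complex) set" where
  "L2 = {f. f \<in> borel_measurable lebesgue \<and> integrable lebesgue (\<lambda>x. (norm (f x))\<^sup>2)}"

definition L2_inner :: "(real ^ 'd \<Rightarrow> complex) \<Rightarrow> (real ^ 'd \<Rightarrow> complex) \<Rightarrow> complex" where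
  "L2_inner f g = (LINT x|lebesgue. f x * cnj (g x))"

definition L2_norm :: "(real ^ 'd \<Rightarrow> complex) \<Rightarrow> real" where
  "L2_norm f = sqrt (LINT x|lebesgue. (norm (f x))\<^sup>2)"

definition L2_frame :: "'i set \<Rightarrow> ('i \<Rightarrow> real ^ 'd \<Rightarrow> complex) \<Rightarrow> bool" where
  "L2_frame I h \<longleftrightarrow>
     (\<forall>i\<in>I. h i \<in> L2) \<and>
     (\<exists>C1 C2. 0 < C1 \<and> 0 < C2 \<and>
       (\<forall>f\<in>L2.
          (\<lambda>i. (norm (L2_inner f (h i)))\<^sup>2) summable_on I \<and>
          C1 * (L2_norm f)\<^sup>2 \<le> (\<Sum>\<^sub>\<infinity>i\<in>I. (norm (L2_inner f (h i)))\<^sup>2) \<and>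
          (\<Sum>\<^sub>\<infinity>i\<in>I. (norm (L2_inner f (h i)))\<^sup>2) \<le> C2 * (L2_norm f)\<^sup>2))"

text \<open>The power \<open>^\<close> on \<^typ>\<open>real ^ 'd ^ 'd\<close> would be taken entrywise, so powers with respect
  to the matrix product \<open>**\<close> are defined here.\<close>

primrec matrix_power :: "real ^ 'd ^ 'd \<Rightarrow> nat \<Rightarrow> real ^ 'd ^ 'd" where
  "matrix_power A 0 = mat 1"
| "matrix_power A (Suc n) = A ** matrix_power A n"

definition matrix_powi :: "real ^ 'd ^ 'd \<Rightarrow> int \<Rightarrow> real ^ 'd ^ 'd" where
  "matrix_powi A j =
     (if 0 \<le> j then matrix_power A (nat j) else matrix_power (matrix_inv A) (nat (- j)))"

text \<open>The eigenvalues in question are the complex ones, hence the passage to a complex matrix.\<close>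

definition expansive :: "real ^ 'd ^ 'd \<Rightarrow> bool" where
  "expansive A \<longleftrightarrow>
     (\<forall>(c::complex) v. v \<noteq> 0 \<and> map_matrix complex_of_real A *v v = c *s v \<longrightarrow> 1 < norm c)"

definition dilate_shift ::
  "real ^ 'd ^ 'd \<Rightarrow> real ^ 'd \<Rightarrow> (real ^ 'd \<Rightarrow> complex) \<Rightarrow> real ^ 'd \<Rightarrow> complex" where
  "dilate_shift U k f = (\<lambda>x. complex_of_real (sqrt \<bar>det U\<bar>) * f (U *v x - k))"

definition int_lattice :: "(real ^ 'd) set" where
  "int_lattice = {k. \<forall>i. k $ i \<in> \<int>}"

text \<open>The index set \<open>{1,\<dots>,r}\<close>: empty for \<open>r = 0\<close>, all positive integers for \<open>r = \<infinity>\<close>.\<close>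

definition gen_index :: "enat \<Rightarrow> nat set" where
  "gen_index r = {l. 1 \<le> l \<and> enat l \<le> r}"

text \<open>Systems are families over explicit index sets, so that coinciding elements are counted with
  multiplicity. In the nonhomogeneous system, \<open>Inl (l, k)\<close> indexes the element
  \<open>\<phi>\<^sup>l\<close> dilated by \<open>M\<^sup>J\<close> and shifted by \<open>k\<close>, and \<open>Inr (j, l, k)\<close> indexes the
  element \<open>\<psi>\<^sup>l\<close> dilated by \<open>M\<^sup>j\<close> and shifted by \<open>k\<close>.\<close>

definition WS :: "real ^ 'd ^ 'd \<Rightarrow> (nat \<Rightarrow> real ^ 'd \<Rightarrow> complex) \<Rightarrow>
    int \<times> nat \<times> (real ^ 'd) \<Rightarrow> real ^ 'd \<Rightarrow> complex" where
  "WS M \<psi> = (\<lambda>(j, l, k). dilate_shift (matrix_powi M j) k (\<psi> l))"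

definition WS_index :: "enat \<Rightarrow> (int \<times> nat \<times> (real ^ 'd)) set" where
  "WS_index s = UNIV \<times> gen_index s \<times> int_lattice"

definition WS_nonhom :: "real ^ 'd ^ 'd \<Rightarrow> int \<Rightarrow> (nat \<Rightarrow> real ^ 'd \<Rightarrow> complex) \<Rightarrow>
    (nat \<Rightarrow> real ^ 'd \<Rightarrow> complex) \<Rightarrow>
    (nat \<times> (real ^ 'd)) + (int \<times> nat \<times> (real ^ 'd)) \<Rightarrow> real ^ 'd \<Rightarrow> complex" where
  "WS_nonhom M J \<phi> \<psi> =
     case_sum (\<lambda>(l, k). dilate_shift (matrix_powi M J) k (\<phi> l)) (WS M \<psi>)"

definition WS_nonhom_index :: "int \<Rightarrow> enat \<Rightarrow> enat \<Rightarrow>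
    ((nat \<times> (real ^ 'd)) + (int \<times> nat \<times> (real ^ 'd))) set" where
  "WS_nonhom_index J r s =
     (gen_index r \<times> int_lattice) <+> ({J..} \<times> gen_index s \<times> int_lattice)"

text \<open>In the two definitions below, the frame inequalities and the Cauchy--Schwarz inequality make
  the products \<open>\<langle>f, h\<^sub>i\<rangle> \<langle>h'\<^sub>i, g\<rangle>\<close> absolutely summable over the whole index set. Every
  \<open>infsum\<close> in the reconstruction identities is therefore a convergent sum.\<close>

definition nonhom_dual_wavelet_frames :: "real ^ 'd ^ 'd \<Rightarrow> int \<Rightarrow> enat \<Rightarrow> enat \<Rightarrow>
    (nat \<Rightarrow> real ^ 'd \<Rightarrow> complex) \<Rightarrow> (nat \<Rightarrow> real ^ 'd \<Rightarrow> complex) \<Rightarrow>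
    (nat \<Rightarrow> real ^ 'd \<Rightarrow> complex) \<Rightarrow> (nat \<Rightarrow> real ^ 'd \<Rightarrow> complex) \<Rightarrow> bool" where
  "nonhom_dual_wavelet_frames M J r s \<phi> \<psi> \<phi>' \<psi>' \<longleftrightarrow>
     L2_frame (WS_nonhom_index J r s) (WS_nonhom M J \<phi> \<psi>) \<and>
     L2_frame (WS_nonhom_index J r s) (WS_nonhom M J \<phi>' \<psi>') \<and>
     (\<forall>f\<in>L2. \<forall>g\<in>L2. L2_inner f g =
        (\<Sum>\<^sub>\<infinity>l\<in>gen_index r. \<Sum>\<^sub>\<infinity>k\<in>int_lattice.
           L2_inner f (dilate_shift (matrix_powi M J) k (\<phi> l)) *
           L2_inner (dilate_shift (matrix_powi M J) k (\<phi>' l)) g) +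
        (\<Sum>\<^sub>\<infinity>j\<in>{J..}. \<Sum>\<^sub>\<infinity>l\<in>gen_index s. \<Sum>\<^sub>\<infinity>k\<in>int_lattice.
           L2_inner f (dilate_shift (matrix_powi M j) k (\<psi> l)) *
           L2_inner (dilate_shift (matrix_powi M j) k (\<psi>' l)) g))"

definition hom_dual_wavelet_frames :: "real ^ 'd ^ 'd \<Rightarrow> enat \<Rightarrow>
    (nat \<Rightarrow> real ^ 'd \<Rightarrow> complex) \<Rightarrow> (nat \<Rightarrow> real ^ 'd \<Rightarrow> complex) \<Rightarrow> bool" where
  "hom_dual_wavelet_frames M s \<psi> \<psi>' \<longleftrightarrow>
     L2_frame (WS_index s) (WS M \<psi>) \<and>
     L2_frame (WS_index s) (WS M \<psi>') \<and>
     (\<forall>f\<in>L2. \<forall>g\<in>L2. L2_inner f g =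
        (\<Sum>\<^sub>\<infinity>j\<in>UNIV. \<Sum>\<^sub>\<infinity>l\<in>gen_index s. \<Sum>\<^sub>\<infinity>k\<in>int_lattice.
           L2_inner f (dilate_shift (matrix_powi M j) k (\<psi> l)) *
           L2_inner (dilate_shift (matrix_powi M j) k (\<psi>' l)) g))"

end

theory Submission
  imports Defs "HOL-Computational_Algebra.Fundamental_Theorem_Algebra"
begin

text \<open>
  Two facts carry the theorem. The first is that dilation by \<open>M\<^sup>n\<close> is a unitary operator of
  \<open>L\<^sub>2\<close> which maps the nonhomogeneous system of level \<open>J\<close> bijectively onto that of level
  \<open>J + n\<close>. Frame bounds and reconstruction formulas are unitarily invariant, so they pass from
  one level to all levels, with the \<^emph>\<open>same\<close> constants
  (\<open>frame_bounds_WS_nonhom_change_level\<close>, \<open>nonhom_dual_wavelet_frames_change_level\<close>).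

  The second is that for expansive \<open>M\<close> and \<open>\<Sum>\<parallel>\<phi>\<^sup>l\<parallel>\<^sup>2 < \<infinity>\<close> the coarse part of the system dies
  out: \<open>\<Sum>\<^sub>l\<^sub>,\<^sub>k \<bar>\<langle>f, \<phi>\<^sup>l\<rangle>\<bar>\<^sup>2\<close>, with \<open>\<phi>\<^sup>l\<close> dilated by \<open>M\<^sup>J\<close> and shifted by \<open>k\<close>, tends to \<open>0\<close> as
  \<open>J \<rightarrow> -\<infinity>\<close> (\<open>coarse_level_tendsto_0\<close>). By the uniform Bessel bound, \<open>f\<close> may be cut down to a
  ball. On that ball \<open>M\<^sup>J\<close> takes values in a tiny ball around \<open>0\<close>, so \<open>f\<close> only meets the part of
  \<open>\<phi>\<^sup>l\<close> that lives within a small distance of \<open>-k\<close>. The balls around different lattice points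
  are disjoint, so all these parts together have square sum at most \<open>\<Sum>\<parallel>\<phi>\<^sup>l\<parallel>\<^sup>2\<close>, and each of
  them vanishes in the limit; dominated convergence for sums finishes the argument.

  Letting \<open>J \<rightarrow> -\<infinity>\<close> in the reconstruction formula of level \<open>J\<close> gives the homogeneous one: by
  Cauchy--Schwarz the coarse term is controlled by the vanishing sum for \<open>\<Phi>\<close> and the Bessel bound
  for the dual generators (\<open>WS_reconstruction\<close>). The upper frame bounds of the homogeneous systems
  hold because every finite part of them already lies in some nonhomogeneous system and the bounds
  are uniform
  (\<open>bessel_bound_WS\<close>). The lower bounds come for free, since two Bessel families that
  reconstruct \<open>\<langle>f, f\<rangle>\<close> are frames (\<open>dual_bessel_imp_frame\<close>).

  Two preparations take some work. The first is the change of variables under an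
  invertible matrix, for integrals over \<^typ>\<open>real ^ 'd\<close> with an arbitrary finite index type
  (\<open>has_bochner_integral_matrix_affine\<close>). The second is that the powers of
  \<open>M\<^sup>-\<^sup>1\<close> tend to \<open>0\<close> when all complex eigenvalues of \<open>M\<close> have modulus greater than one
  (\<open>expansive_inv_power_tendsto_0\<close>).
\<close>

section \<open>Affine change of variables over an arbitrary finite index type\<close>

text \<open>The formula \<open>measure_linear_image\<close> for the volume of a linear image rests on elimination, which runs
  through the indices in a fixed order, so it is about well-ordered index types. It is carried over to
  \<^typ>\<open>real ^ 'd\<close> for every finite \<open>'d\<close> by renaming the coordinates with this ordered type, which
  has as many elements as \<open>'d\<close>.\<close>

typedef (overloaded) 'd ordered_copy = "{i. i < CARD('d::finite)}"
proof
  show "0 \<in> {i. i < CARD('d)}" by simp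
qed

instance ordered_copy :: (finite) finite
proof
  have "finite (Abs_ordered_copy ` {i. i < CARD('a)} :: 'a ordered_copy set)"
    by simp
  then show "finite (UNIV :: 'a ordered_copy set)"
    by (metis type_definition.univ type_definition_ordered_copy)
qed

instantiation ordered_copy :: (finite) linorder
begin

definition "a < b \<longleftrightarrow> Rep_ordered_copy a < Rep_ordered_copy b"
definition "a \<le> b \<longleftrightarrow> Rep_ordered_copy a \<le> Rep_ordered_copy b"

instance
  by intro_classes
    (auto simp: less_eq_ordered_copy_def less_ordered_copy_def Rep_ordered_copy_inject dest: order.antisym)

end

instance ordered_copy :: (finite) wellorder
proof -
  have "wf {(x :: 'a ordered_copy, y). x < y}"
    by (auto simp: trancl_def tranclp_less intro!: finite_acyclic_wf acyclicI)
  then show "OFCLASS('a ordered_copy, wellorder_class)"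
    by (rule wf_wellorderI) intro_classes
qed

lemma ex_bij_ordered_copy: "\<exists>\<rho> :: 'd::finite ordered_copy \<Rightarrow> 'd. bij \<rho>"
proof -
  have "CARD('d ordered_copy) = CARD('d)"
    using type_definition.card[OF type_definition_ordered_copy] by simp
  then show ?thesis
    using bij_betw_iff_card[of "UNIV :: 'd ordered_copy set" "UNIV :: 'd set"] by simp
qed

text \<open>In the Leibniz formula, conjugation by \<open>\<rho>\<close> permutes the summands and keeps the signs.\<close>

lemma det_reindex:
  fixes A :: "real ^ 'd ^ 'd" and \<rho> :: "'n::finite \<Rightarrow> 'd"
  assumes "bij \<rho>"
  shows "det (\<chi> i j. A $ \<rho> i $ \<rho> j :: real ^ 'n ^ 'n) = det A"
proof -
  let ?m = "map_permutation UNIV \<rho>"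
  have inj: "inj \<rho>" and rng: "range \<rho> = UNIV"
    using assms by (auto simp: bij_def)
  have bij: "bij_betw ?m {p. p permutes UNIV} {p. p permutes UNIV}"
  proof -
    have "bij_betw (\<lambda>p x. if x \<in> UNIV then \<rho> (p (inv_into UNIV \<rho> x)) else x)
             {p. p permutes UNIV} {p. p permutes UNIV}"
      by (rule bij_betw_permutations) (use assms in simp)
    also have "(\<lambda>p x. if x \<in> UNIV then \<rho> (p (inv_into UNIV \<rho> x)) else x) = ?m"
      by (auto simp: map_permutation_def restrict_id_def fun_eq_iff rng)
    finally show ?thesis .
  qed
  have "det A = (\<Sum>p\<in>{p. p permutes UNIV}. of_int (sign (?m p)) * (\<Prod>i\<in>UNIV. A $ i $ ?m p i))"
    unfolding det_def by (rule sum.reindex_bij_betw[OF bij, symmetric])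
  also have "\<dots> = (\<Sum>p\<in>{p. p permutes UNIV}. of_int (sign p) * (\<Prod>i\<in>UNIV. A $ \<rho> i $ \<rho> (p i)))"
  proof (rule sum.cong)
    fix p :: "'n \<Rightarrow> 'n" assume "p \<in> {p. p permutes UNIV}"
    then have p: "p permutes UNIV" by simp
    have "(\<Prod>i\<in>UNIV. A $ i $ ?m p i) = (\<Prod>i\<in>UNIV. A $ \<rho> i $ ?m p (\<rho> i))"
      by (rule prod.reindex_bij_betw[symmetric]) (use assms in simp)
    also have "\<dots> = (\<Prod>i\<in>UNIV. A $ \<rho> i $ \<rho> (p i))"
      by (simp add: map_permutation_apply inj)
    finally show "of_int (sign (?m p)) * (\<Prod>i\<in>UNIV. A $ i $ ?m p i)
        = of_int (sign p) * (\<Prod>i\<in>UNIV. A $ \<rho> i $ \<rho> (p i))"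
      using sign_map_permutation[OF inj p] by simp
  qed simp
  finally show ?thesis
    by (simp add: det_def)
qed

lemma emeasure_box_cart:
  fixes l u :: "real ^ 'd"
  assumes "\<And>i. l $ i \<le> u $ i"
  shows "emeasure lborel (box l u) = ennreal (\<Prod>i\<in>UNIV. u $ i - l $ i)"
proof -
  have "(\<Prod>b\<in>Basis. (u - l) \<bullet> b) = (\<Prod>i\<in>UNIV. u $ i - l $ i)"
  proof -
    have "inj (\<lambda>i :: 'd. axis i (1 :: real))"
      by (auto simp: inj_on_def axis_eq_axis)
    then show ?thesis
      by (simp add: Basis_vec_def UNION_singleton_eq_range prod.reindex inner_axis)
  qed
  moreover have "\<forall>b\<in>Basis. l \<bullet> b \<le> u \<bullet> b"
    using assms by (auto simp: Basis_vec_def inner_axis)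
  ultimately show ?thesis
    by (simp add: emeasure_lborel_box_eq)
qed

text \<open>Renaming coordinates maps boxes to boxes with the same edge lengths.\<close>

lemma lborel_reindex_coordinates:
  fixes \<rho> :: "'n::finite \<Rightarrow> 'd::finite"
  assumes "bij \<rho>"
  shows "distr lborel borel (\<lambda>x :: real ^ 'd. \<chi> i. x $ \<rho> i) = (lborel :: (real ^ 'n) measure)"
proof (rule lborel_eqI[symmetric])
  let ?P = "\<lambda>x :: real ^ 'd. \<chi> i. x $ \<rho> i"
  let ?Q = "\<lambda>x :: real ^ 'n. \<chi> i. x $ inv \<rho> i"
  have [measurable]: "?P \<in> borel_measurable borel"
    by (intro borel_measurable_continuous_onI continuous_intros)
  fix l u :: "real ^ 'n" assume le: "\<And>b. b \<in> Basis \<Longrightarrow> l \<bullet> b \<le> u \<bullet> b"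
  then have le': "l $ i \<le> u $ i" for i
    using le[of "axis i 1"] by (auto simp: inner_axis Basis_vec_def)
  have inv: "inv \<rho> (\<rho> i) = i" "\<rho> (inv \<rho> j) = j" for i j
    using assms by (auto simp: bij_def surj_f_inv_f)
  have "?P -` box l u = box (?Q l) (?Q u)"
    by (auto simp: mem_box_cart) (metis inv)+
  then have "emeasure (distr lborel borel ?P) (box l u) = emeasure lborel (box (?Q l) (?Q u))"
    by (simp add: emeasure_distr)
  also have "\<dots> = ennreal (\<Prod>j\<in>UNIV. u $ inv \<rho> j - l $ inv \<rho> j)"
    by (subst emeasure_box_cart) (auto simp: le')
  also have "(\<Prod>j\<in>UNIV. u $ inv \<rho> j - l $ inv \<rho> j) = (\<Prod>i\<in>UNIV. u $ i - l $ i)"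
    by (rule prod.reindex_bij_betw) (use assms in \<open>simp add: bij_imp_bij_inv\<close>)
  also have "ennreal \<dots> = emeasure lborel (box l u)"
    by (subst emeasure_box_cart) (auto simp: le')
  also have "\<dots> = (\<Prod>b\<in>Basis. (u - l) \<bullet> b)"
    using le by (simp add: emeasure_lborel_box_eq)
  finally show "emeasure (distr lborel borel ?P) (box l u) = (\<Prod>b\<in>Basis. (u - l) \<bullet> b)" .
qed simp

text \<open>The preimage is the image under the inverse matrix, whose volume is known here. The general case
  below conjugates with the renaming of coordinates.\<close>

lemma emeasure_linear_vimage_box_wellorder:
  fixes A :: "real ^ 'n::{finite,wellorder} ^ 'n::_"
  assumes "det A \<noteq> 0"
  shows "ennreal \<bar>det A\<bar> * emeasure lborel ((*v) A -` box l u) = emeasure lborel (box l u)"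
proof -
  obtain B where B: "A ** B = mat 1" "B ** A = mat 1"
    using assms by (metis invertible_det_nz invertible_def)
  have eq: "(*v) A -` box l u = (*v) B ` box l u"
  proof safe
    fix x assume "A *v x \<in> box l u"
    moreover have "x = B *v (A *v x)" by (simp add: matrix_vector_mul_assoc B)
    ultimately show "x \<in> (*v) B ` box l u" by blast
  qed (simp add: matrix_vector_mul_assoc B)
  have meas: "(*v) A -` box l u \<in> sets borel"
    by (intro measurable_sets_borel[of _ borel] borel_measurable_continuous_onI) (auto intro!: continuous_intros)
  have "det A * det B = 1"
    using B by (metis det_I det_mul)
  then have det: "\<bar>det A\<bar> * \<bar>det B\<bar> = 1" by (metis abs_mult abs_one)
  have fin: "(*v) B ` box l u \<in> lmeasurable"
    by (rule measurable_linear_image) auto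
  have "measure lebesgue ((*v) B ` box l u) = \<bar>det B\<bar> * measure lebesgue (box l u)"
    by (subst measure_linear_image) auto
  then have "\<bar>det A\<bar> * measure lebesgue ((*v) B ` box l u) = measure lebesgue (box l u)"
    using det by (simp flip: mult.assoc)
  then have "ennreal \<bar>det A\<bar> * emeasure lebesgue ((*v) B ` box l u) = emeasure lebesgue (box l u)"
    using fin by (simp add: emeasure_eq_measure2 ennreal_mult' flip: ennreal_mult'')
  then show ?thesis
    using meas by (simp add: eq emeasure_completion)
qed

lemma emeasure_linear_vimage_box:
  fixes A :: "real ^ 'd ^ 'd"
  assumes "det A \<noteq> 0"
  shows "ennreal \<bar>det A\<bar> * emeasure lborel ((*v) A -` box l u) = emeasure lborel (box l u)"
proof -
  obtain \<rho> :: "'d ordered_copy \<Rightarrow> 'd" where \<rho>: "bij \<rho>"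
    using ex_bij_ordered_copy by blast
  define P where "P = (\<lambda>x :: real ^ 'd. \<chi> i. x $ \<rho> i)"
  define B :: "real ^ 'd ordered_copy ^ 'd ordered_copy" where "B = (\<chi> i j. A $ \<rho> i $ \<rho> j)"
  have det: "det B = det A"
    unfolding B_def by (rule det_reindex[OF \<rho>])
  have [measurable]: "P \<in> borel_measurable borel"
    unfolding P_def by (intro borel_measurable_continuous_onI continuous_intros)
  have lborel: "lborel = distr lborel borel P"
    unfolding P_def by (rule lborel_reindex_coordinates[OF \<rho>, symmetric])
  have conj: "P (A *v x) = B *v P x" for x
    unfolding P_def B_def matrix_vector_mult_def
    by (auto simp: vec_eq_iff intro!: sum.reindex_bij_betw[symmetric] \<rho>)
  have vimage: "P -` box (P l) (P u) = box l u"
    using \<rho> by (auto simp: P_def mem_box_cart bij_def surj_def) metis+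
  have meas [measurable]: "(*v) B -` box (P l) (P u) \<in> sets borel"
    by (intro measurable_sets_borel[of _ borel] borel_measurable_continuous_onI)
      (auto intro!: continuous_intros)
  have "P -` ((*v) B -` box (P l) (P u)) = (*v) A -` box l u"
    using vimage by (auto simp flip: conj)
  moreover have "emeasure lborel ((*v) B -` box (P l) (P u)) = emeasure lborel (P -` ((*v) B -` box (P l) (P u)))"
    by (subst lborel) (simp add: emeasure_distr meas)
  moreover have "emeasure lborel (box (P l) (P u)) = emeasure lborel (P -` box (P l) (P u))"
    by (subst lborel) (simp add: emeasure_distr)
  ultimately show ?thesis
    using emeasure_linear_vimage_box_wellorder[of B "P l" "P u"] assms by (simp add: det vimage)
qed

lemma lborel_matrix_affine:
  fixes A :: "real ^ 'd ^ 'd"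
  assumes "det A \<noteq> 0"
  shows "lborel = density (distr lborel borel (\<lambda>x. A *v x - k)) (\<lambda>_. ennreal \<bar>det A\<bar>)" (is "_ = ?D")
proof (rule lborel_eqI)
  have [measurable]: "(\<lambda>x. A *v x - k) \<in> borel_measurable borel"
    by (intro borel_measurable_continuous_onI continuous_intros)
  fix l u :: "real ^ 'd" assume le: "\<And>b. b \<in> Basis \<Longrightarrow> l \<bullet> b \<le> u \<bullet> b"
  have "(\<lambda>x. A *v x - k) -` box l u = (*v) A -` box (l + k) (u + k)"
    by (auto simp: mem_box_cart algebra_simps)
  then have "emeasure ?D (box l u) = emeasure lborel (box (l + k) (u + k))"
    using emeasure_linear_vimage_box[OF assms, of "l + k" "u + k"]
    by (simp add: emeasure_density nn_integral_cmult emeasure_distr)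
  then show "emeasure ?D (box l u) = (\<Prod>b\<in>Basis. (u - l) \<bullet> b)"
    using le by (simp add: emeasure_lborel_box_eq inner_simps)
qed simp

text \<open>Lebesgue measure is the completion of Borel measure, and the affine map preserves null sets, so the
  Borel statement passes to the completion.\<close>

lemma
  fixes A :: "real ^ 'd ^ 'd" and k :: "real ^ 'd"
  assumes det: "det A \<noteq> 0"
  defines "T \<equiv> (\<lambda>x. A *v x - k)"
  shows lebesgue_matrix_affine: "lebesgue = density (distr lebesgue lebesgue T) (\<lambda>_. ennreal \<bar>det A\<bar>)"
    and measurable_matrix_affine: "T \<in> lebesgue \<rightarrow>\<^sub>M lebesgue"
proof -
  have T_borel[measurable]: "T \<in> borel \<rightarrow>\<^sub>M borel"
    unfolding T_def by (intro borel_measurable_continuous_onI continuous_intros)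
  note lborel = lborel_matrix_affine[OF det, of k, folded T_def]
  { fix S :: "(real ^ 'd) set" assume S: "S \<in> sets borel"
    have "emeasure lborel S = 0 \<longleftrightarrow> emeasure (density (distr lborel borel T) (\<lambda>_. ennreal \<bar>det A\<bar>)) S = 0"
      using lborel by simp
    also have "\<dots> \<longleftrightarrow> emeasure (distr lebesgue lborel T) S = 0"
      using S det by (simp add: distr_completion emeasure_density nn_integral_cmult cong: distr_cong)
    finally have "emeasure lborel S = 0 \<longleftrightarrow> emeasure (distr lebesgue lborel T) S = 0" . }
  then have eq: "null_sets lborel = null_sets (distr lebesgue lborel T)"
    by (auto simp: null_sets_def)
  show "T \<in> lebesgue \<rightarrow>\<^sub>M lebesgue"
    by (simp add: completion.measurable_completion2 eq measurable_completion)
  have "lebesgue = completion (density (distr lborel borel T) (\<lambda>_. ennreal \<bar>det A\<bar>))"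
    using lborel by simp
  also have "\<dots> = density (completion (distr lebesgue lborel T)) (\<lambda>_. ennreal \<bar>det A\<bar>)"
    using det by (auto intro!: always_eventually completion_density_eq simp: distr_completion cong: distr_cong)
  also have "\<dots> = density (distr lebesgue lebesgue T) (\<lambda>_. ennreal \<bar>det A\<bar>)"
    by (subst completion.completion_distr_eq) (auto simp: eq measurable_completion)
  finally show "lebesgue = density (distr lebesgue lebesgue T) (\<lambda>_. ennreal \<bar>det A\<bar>)" .
qed

lemma has_bochner_integral_matrix_affine:
  fixes A :: "real ^ 'd ^ 'd" and F :: "real ^ 'd \<Rightarrow> 'b::{banach, second_countable_topology}"
  assumes det: "det A \<noteq> 0" and F: "has_bochner_integral lebesgue F I"
  shows "has_bochner_integral lebesgue (\<lambda>x. \<bar>det A\<bar> *\<^sub>R F (A *v x - k)) I"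
proof -
  note [measurable] = measurable_matrix_affine[OF det, of k]
  have [measurable]: "F \<in> borel_measurable lebesgue" and int: "integrable lebesgue F" and I: "I = (LINT x|lebesgue. F x)"
    using F by (auto simp: has_bochner_integral_iff)
  let ?D = "distr lebesgue lebesgue (\<lambda>x. A *v x - k)"
  have "has_bochner_integral (density ?D (\<lambda>_. ennreal \<bar>det A\<bar>)) F I"
    using F lebesgue_matrix_affine[OF det, of k] by simp
  then have "has_bochner_integral ?D (\<lambda>x. \<bar>det A\<bar> *\<^sub>R F x) I"
    by (simp add: has_bochner_integral_iff integrable_density integral_density)
  then show ?thesis
    by (simp add: has_bochner_integral_iff integrable_distr_eq integral_distr)
qed

section \<open>Inverse powers of expansive matrices\<close>

text \<open>Once the perturbation is below \<open>e (1 - \<bar>c\<bar>) / 2\<close>, the fixed point of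
  \<open>t \<mapsto> \<bar>c\<bar> t + e (1 - \<bar>c\<bar>) / 2\<close> is \<open>e / 2\<close>, and \<open>\<parallel>x n\<parallel>\<close> exceeds it by at most a geometrically
  decreasing amount.\<close>

lemma perturbed_contraction_tendsto_0:
  fixes x u :: "nat \<Rightarrow> 'a::real_normed_field"
  assumes rec: "\<And>n. x (Suc n) = c * x n + u n" and c: "norm c < 1" and u: "u \<longlonglongrightarrow> 0"
  shows "x \<longlonglongrightarrow> 0"
proof (rule LIMSEQ_I)
  fix e :: real assume "e > 0"
  then have "e * (1 - norm c) / 2 > 0" using c by simp
  then obtain N where N: "\<And>n. n \<ge> N \<Longrightarrow> norm (u n) < e * (1 - norm c) / 2"
    using LIMSEQ_D[OF u, of "e * (1 - norm c) / 2"] by auto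
  have bound: "norm (x (N + m)) \<le> norm c ^ m * norm (x N) + e / 2" for m
  proof (induction m)
    case (Suc m)
    have "norm (x (N + Suc m)) \<le> norm c * norm (x (N + m)) + norm (u (N + m))"
      using norm_triangle_ineq[of "c * x (N + m)" "u (N + m)"] by (simp add: rec norm_mult)
    also have "\<dots> \<le> norm c * (norm c ^ m * norm (x N) + e / 2) + e * (1 - norm c) / 2"
      using Suc N[of "N + m"] by (intro add_mono mult_left_mono) auto
    finally show ?case by (simp add: algebra_simps add_divide_distrib diff_divide_distrib)
  qed (use \<open>e > 0\<close> in simp)
  have "(\<lambda>m. norm c ^ m * norm (x N)) \<longlonglongrightarrow> 0 * norm (x N)"
    by (intro tendsto_intros LIMSEQ_power_zero) (use c in simp)
  then obtain m0 where m0: "\<And>m. m \<ge> m0 \<Longrightarrow> norm c ^ m * norm (x N) < e / 2"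
    using LIMSEQ_D[of "\<lambda>m. norm c ^ m * norm (x N)" 0 "e / 2"] \<open>e > 0\<close> by auto
  have "norm (x n - 0) < e" if "n \<ge> N + m0" for n
  proof -
    have "N + (n - N) = n" "m0 \<le> n - N" using that by auto
    then show ?thesis using bound[of "n - N"] m0[of "n - N"] by simp
  qed
  then show "\<exists>n0. \<forall>n\<ge>n0. norm (x n - 0) < e" by blast
qed

text \<open>This is \<open>p(A) v\<close>, written without forming the matrix \<open>p(A)\<close> because only annihilation of single
  vectors matters below.\<close>

definition poly_apply :: "'a::field ^ 'n ^ 'n \<Rightarrow> 'a poly \<Rightarrow> 'a ^ 'n \<Rightarrow> 'a ^ 'n" where
  "poly_apply A p v = (\<Sum>i\<le>degree p. coeff p i *s ((*v) A ^^ i) v)"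

lemma poly_apply_atMost:
  assumes "degree p \<le> n"
  shows "poly_apply A p v = (\<Sum>i\<le>n. coeff p i *s ((*v) A ^^ i) v)"
  unfolding poly_apply_def
  by (rule sum.mono_neutral_left) (use assms in \<open>auto simp: coeff_eq_0\<close>)

lemma funpow_matrix_add:
  fixes A :: "'a::field ^ 'n ^ 'n"
  shows "((*v) A ^^ n) (v + w) = ((*v) A ^^ n) v + ((*v) A ^^ n) w"
  by (induction n) (auto simp: matrix_vector_right_distrib)

lemma funpow_matrix_scale:
  fixes A :: "'a::field ^ 'n ^ 'n"
  shows "((*v) A ^^ n) (c *s v) = c *s ((*v) A ^^ n) v"
  by (induction n) (auto simp: matrix_vector_mult_scaleR vector_scalar_commute)

lemma poly_apply_add: "poly_apply A (p + q) v = poly_apply A p v + poly_apply A q v"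
  using degree_add_le_max[of p q]
  by (simp add: poly_apply_atMost[of _ "max (degree p) (degree q)"] sum.distrib vec.scale_left_distrib)

lemma poly_apply_smult: "poly_apply A (smult c p) v = c *s poly_apply A p v"
  by (simp add: poly_apply_atMost[of _ "degree p"] vec.scale_sum_right)

lemma poly_apply_shift: "poly_apply A (pCons 0 p) v = poly_apply A p (A *v v)"
proof -
  have "poly_apply A (pCons 0 p) v = (\<Sum>i\<le>Suc (degree p). coeff (pCons 0 p) i *s ((*v) A ^^ i) v)"
    by (rule poly_apply_atMost) (simp add: degree_pCons_le)
  also have "\<dots> = (\<Sum>i\<le>degree p. coeff p i *s ((*v) A ^^ Suc i) v)"
    by (subst sum.atMost_Suc_shift) simp
  finally show ?thesis
    by (simp add: poly_apply_def funpow_swap1)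
qed

lemma poly_apply_vec_add: "poly_apply A p (v + w) = poly_apply A p v + poly_apply A p w"
  by (simp add: poly_apply_def funpow_matrix_add vec.scale_right_distrib sum.distrib)

lemma poly_apply_vec_scale: "poly_apply A p (c *s v) = c *s poly_apply A p v"
  by (simp add: poly_apply_def funpow_matrix_scale vec.scale_sum_right mult.commute)

lemma poly_apply_commute: "poly_apply A p (A *v v) = A *v poly_apply A p v"
  by (simp add: poly_apply_def vec.linear_sum[OF matrix_vector_mul_linear_gen] vector_scalar_commute funpow_swap1)

text \<open>Since \<open>p = (X - c) q\<close> gives \<open>p(A) v = q(A) (A v - c v)\<close>, a root of an annihilating polynomial
  can be traded for a change of vector.\<close>

lemma poly_apply_linear_factor:
  "poly_apply A ([:- c, 1:] * q) v = poly_apply A q (A *v v - c *s v)"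
proof -
  have "[:- c, 1:] * q = smult (- c) q + pCons 0 q"
    by simp
  then have "poly_apply A ([:- c, 1:] * q) v = (- c) *s poly_apply A q v + poly_apply A q (A *v v)"
    by (simp only: poly_apply_add poly_apply_smult poly_apply_shift)
  also have "\<dots> = poly_apply A q ((- c) *s v + A *v v)"
    by (simp only: poly_apply_vec_add poly_apply_vec_scale)
  finally show ?thesis by (simp add: vec.scale_minus_left)
qed

text \<open>The vectors \<open>v, A v, \<dots>, A\<^sup>N v\<close>, with \<open>N\<close> the dimension, are linearly dependent. A dependency of
  the set of these vectors yields one of the family; if two of the vectors coincide, their
  difference is a dependency.\<close>

lemma ex_annihilating_poly:
  fixes A :: "'a::field ^ 'n ^ 'n"
  shows "\<exists>p. p \<noteq> 0 \<and> poly_apply A p v = 0"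
proof -
  define f where "f i = ((*v) A ^^ i) v" for i
  define N where "N = CARD('n)"
  have "\<exists>a. (\<exists>i\<le>N. a i \<noteq> 0) \<and> (\<Sum>i\<le>N. a i *s f i) = 0"
  proof (cases "inj_on f {..N}")
    case True
    then have "card (f ` {..N}) = Suc N" by (simp add: card_image)
    then have "vec.dependent (f ` {..N})"
      by (intro vec.dependent_biggerset_general) (use vec.dim_subset_UNIV[of "f ` {..N}"] in
          \<open>auto simp: N_def vec_dim_card vec.dimension_def card_cart_basis dim_subset_UNIV_cart_gen less_Suc_eq_le\<close>)
    then obtain u where u: "\<exists>w\<in>f ` {..N}. u w \<noteq> 0" "(\<Sum>w\<in>f ` {..N}. u w *s w) = 0"
      by (auto simp: vec.dependent_finite)
    have "(\<Sum>i\<le>N. u (f i) *s f i) = 0"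
      using u(2) by (simp add: sum.reindex[OF True])
    then show ?thesis using u(1) by (intro exI[of _ "u \<circ> f"]) auto
  next
    case False
    then obtain i j where ij: "i \<le> N" "j \<le> N" "i \<noteq> j" "f i = f j"
      by (auto simp: inj_on_def)
    define a where "a k = (if k = i then 1 else if k = j then -1 else (0::'a))" for k
    have "(\<Sum>k\<le>N. a k *s f k) = (\<Sum>k\<in>{i,j}. a k *s f k)"
      by (rule sum.mono_neutral_right) (use ij in \<open>auto simp: a_def\<close>)
    also have "\<dots> = 0" using ij by (simp add: a_def vec.scale_minus_left)
    finally show ?thesis using ij by (intro exI[of _ a]) (auto simp: a_def)
  qed
  then obtain a i where a: "i \<le> N" "a i \<noteq> 0" "(\<Sum>i\<le>N. a i *s f i) = 0" by blast
  define p where "p = (\<Sum>k\<le>N. monom (a k) k)"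
  have coeff: "coeff p k = (if k \<le> N then a k else 0)" for k
    by (simp add: p_def coeff_sum sum.delta')
  have "degree p \<le> N"
    by (rule degree_le) (simp add: coeff)
  then have "poly_apply A p v = 0"
    using a by (simp add: poly_apply_atMost coeff f_def)
  moreover have "p \<noteq> 0" using a coeff[of i] by auto
  ultimately show ?thesis by blast
qed

text \<open>Induction on the degree of the annihilating polynomial \<open>p = (X - c) q\<close>. The vector
  \<open>w = A v - c v\<close> is annihilated by \<open>q\<close>, so \<open>A\<^sup>n w \<rightarrow> 0\<close> by induction. Either \<open>q(A) v = 0\<close>, and
  the induction hypothesis applies to \<open>v\<close> itself, or \<open>q(A) v\<close> is an eigenvector for \<open>c\<close>. Then
  \<open>\<bar>c\<bar> < 1\<close>, and \<open>A\<^sup>n\<^sup>+\<^sup>1 v = c A\<^sup>n v + A\<^sup>n w\<close> is a perturbed contraction.\<close>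

lemma funpow_tendsto_0_of_annihilated:
  fixes A :: "complex ^ 'n ^ 'n"
  assumes eig: "\<And>c w. w \<noteq> 0 \<Longrightarrow> A *v w = c *s w \<Longrightarrow> norm c < 1"
    and "p \<noteq> 0" and "poly_apply A p v = 0"
  shows "(\<lambda>n. (((*v) A ^^ n) v) $ i) \<longlonglongrightarrow> 0"
  using assms(2,3)
proof (induction "degree p" arbitrary: p v)
  case 0
  from 0(1) obtain a where "p = [:a:]" by (metis degree_eq_zeroE)
  with 0 have "v = 0" by (simp add: poly_apply_def)
  then have "((*v) A ^^ n) v = 0" for n by (induction n) auto
  then show ?case by simp
next
  case (Suc k)
  have "\<not> constant (poly p)" using Suc.hyps(2) by (simp add: constant_degree flip: Suc.hyps(2))
  then obtain c where "poly p c = 0" using fundamental_theorem_of_algebra by blast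
  then obtain q where q: "p = [:- c, 1:] * q" by (auto simp: poly_eq_0_iff_dvd)
  then have "q \<noteq> 0" using Suc.prems by auto
  then have "degree p = 1 + degree q" unfolding q by (subst degree_mult_eq) auto
  then have deg: "k = degree q" using Suc.hyps(2) by simp
  define w where "w = A *v v - c *s v"
  have w0: "poly_apply A q w = 0"
    using Suc.prems by (simp only: q poly_apply_linear_factor w_def)
  show ?case
  proof (cases "poly_apply A q v = 0")
    case True
    then show ?thesis using Suc.hyps(1)[OF deg \<open>q \<noteq> 0\<close>] by blast
  next
    case False
    have Av: "A *v v = w + c *s v" by (simp add: w_def)
    have "A *v poly_apply A q v = poly_apply A q (w + c *s v)"
      by (simp only: Av flip: poly_apply_commute)
    also have "\<dots> = c *s poly_apply A q v"
      by (simp add: poly_apply_vec_add poly_apply_vec_scale w0)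
    finally have "A *v poly_apply A q v = c *s poly_apply A q v" .
    then have c: "norm c < 1" using eig False by blast
    have "((*v) A ^^ Suc n) v = c *s ((*v) A ^^ n) v + ((*v) A ^^ n) w" for n
      by (simp only: funpow_Suc_right o_apply Av funpow_matrix_add funpow_matrix_scale add.commute)
    then have "(((*v) A ^^ Suc n) v) $ i = c * (((*v) A ^^ n) v) $ i + (((*v) A ^^ n) w) $ i" for n
      by simp
    then show ?thesis
      using c Suc.hyps(1)[OF deg \<open>q \<noteq> 0\<close> w0] by (rule perturbed_contraction_tendsto_0)
  qed
qed

lemma matrix_inv_cancel:
  fixes M :: "real ^ 'd ^ 'd"
  assumes "invertible M"
  shows "M ** matrix_inv M = mat 1" "matrix_inv M ** M = mat 1"
  using someI_ex[OF assms[unfolded invertible_def]] unfolding matrix_inv_def by auto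

text \<open>The eigenvalues of the inverse are the inverses of the eigenvalues, hence of modulus less than
  one. The real matrix is compared with its complexification because the eigenvalues are complex.\<close>

lemma expansive_inv_power_tendsto_0:
  fixes M :: "real ^ 'd ^ 'd"
  assumes inv: "invertible M" and exp: "expansive M"
  shows "(\<lambda>n. matrix_power (matrix_inv M) n *v v) \<longlonglongrightarrow> 0"
proof (rule vec_tendstoI)
  fix i
  define cpl :: "real ^ 'd \<Rightarrow> complex ^ 'd" where "cpl v = (\<chi> i. of_real (v $ i))" for v
  define A where "A = map_matrix complex_of_real (matrix_inv M)"
  have A: "map_matrix complex_of_real M *v (A *v w) = w" for w
  proof -
    have "map_matrix complex_of_real M ** A = map_matrix complex_of_real (M ** matrix_inv M)"
      by (simp add: A_def map_matrix_def matrix_matrix_mult_def vec_eq_iff)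
    also have "\<dots> = mat 1"
      by (simp add: matrix_inv_cancel[OF inv] map_matrix_def vec_eq_iff mat_def)
    finally have "map_matrix complex_of_real M ** A = mat 1" .
    then show ?thesis by (simp add: matrix_vector_mul_assoc)
  qed
  have eig: "norm c < 1" if "w \<noteq> 0" "A *v w = c *s w" for c w
  proof -
    have *: "c *s (map_matrix complex_of_real M *v w) = w"
      using A[of w] that(2) by (simp add: vector_scalar_commute)
    then have "c \<noteq> 0" using that(1) by auto
    then have "map_matrix complex_of_real M *v w = (1 / c) *s w"
      by (subst *[symmetric]) simp
    then have "1 < norm (1 / c)"
      using exp that(1) unfolding expansive_def by blast
    then show ?thesis using \<open>c \<noteq> 0\<close> by (simp add: norm_divide)
  qed
  obtain p where "p \<noteq> 0" "poly_apply A p (cpl v) = 0"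
    using ex_annihilating_poly by blast
  then have "(\<lambda>n. (((*v) A ^^ n) (cpl v)) $ i) \<longlonglongrightarrow> 0"
    using funpow_tendsto_0_of_annihilated eig by blast
  moreover have "((*v) A ^^ n) (cpl v) = cpl (matrix_power (matrix_inv M) n *v v)" for n
  proof (induction n)
    case (Suc n)
    have "A *v cpl x = cpl (matrix_inv M *v x)" for x
      by (simp add: A_def cpl_def map_matrix_def matrix_vector_mult_def vec_eq_iff)
    then show ?case using Suc by (simp add: matrix_vector_mul_assoc)
  qed simp
  ultimately have "(\<lambda>n. complex_of_real ((matrix_power (matrix_inv M) n *v v) $ i)) \<longlonglongrightarrow> of_real 0"
    by (simp add: cpl_def)
  then show "(\<lambda>n. (matrix_power (matrix_inv M) n *v v) $ i) \<longlonglongrightarrow> 0 $ i"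
    by (simp only: tendsto_of_real_iff zero_index)
qed

text \<open>Pointwise convergence on the standard basis suffices for uniform convergence on bounded sets.\<close>

lemma expansive_inv_power_shrinks_balls:
  fixes M :: "real ^ 'd ^ 'd"
  assumes "invertible M" "expansive M" "e > 0"
  shows "\<forall>\<^sub>F n in sequentially. \<forall>x. norm x \<le> R \<longrightarrow> norm (matrix_power (matrix_inv M) n *v x) < e"
proof -
  let ?B = "\<lambda>n. matrix_power (matrix_inv M) n"
  have "(\<lambda>n. \<bar>R\<bar> * (\<Sum>i\<in>UNIV. norm (?B n *v axis i 1))) \<longlonglongrightarrow> \<bar>R\<bar> * (\<Sum>i\<in>(UNIV :: 'd set). norm (0 :: real ^ 'd))"
    by (intro tendsto_intros expansive_inv_power_tendsto_0 assms)
  then have "\<forall>\<^sub>F n in sequentially. \<bar>R\<bar> * (\<Sum>i\<in>UNIV. norm (?B n *v axis i 1)) < e"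
    using assms(3) by (intro order_tendstoD(2)) auto
  then show ?thesis
  proof eventually_elim
    case (elim n)
    show ?case
    proof (intro allI impI)
      fix x :: "real ^ 'd" assume x: "norm x \<le> R"
      have "?B n *v x = ?B n *v (\<Sum>i\<in>UNIV. x $ i *s axis i 1)"
        by (simp add: basis_expansion)
      also have "\<dots> = (\<Sum>i\<in>UNIV. x $ i *s (?B n *v axis i 1))"
        by (simp add: vec.linear_sum[OF matrix_vector_mul_linear_gen] vector_scalar_commute)
      also have "norm \<dots> \<le> (\<Sum>i\<in>UNIV. \<bar>R\<bar> * norm (?B n *v axis i 1))"
      proof (rule sum_norm_le)
        fix i
        have "\<bar>x $ i\<bar> \<le> \<bar>R\<bar>" using x component_le_norm_cart[of x i] by linarith
        then show "norm (x $ i *s (?B n *v axis i 1)) \<le> \<bar>R\<bar> * norm (?B n *v axis i 1)"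
          by (simp add: scalar_mult_eq_scaleR mult_right_mono)
      qed
      finally show "norm (?B n *v x) < e"
        using elim by (simp add: sum_distrib_left)
    qed
  qed
qed

section \<open>Square-integrable functions and dilations\<close>

lemma L2_I:
  assumes "f \<in> borel_measurable lebesgue" "integrable lebesgue (\<lambda>x. (norm (f x))\<^sup>2)"
  shows "f \<in> L2"
  using assms by (simp add: L2_def)

lemma L2_measurable: "f \<in> L2 \<Longrightarrow> f \<in> borel_measurable lebesgue"
  and L2_integrable: "f \<in> L2 \<Longrightarrow> integrable lebesgue (\<lambda>x. (norm (f x))\<^sup>2)"
  by (simp_all add: L2_def)

lemma L2_norm_square: "(L2_norm f)\<^sup>2 = (LINT x|lebesgue. (norm (f x))\<^sup>2)"
  by (simp add: L2_norm_def)

lemma L2_integrable_norm_mult: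
  assumes "f \<in> L2" "g \<in> L2"
  shows "integrable lebesgue (\<lambda>x. norm (f x) * norm (g x))"
proof (rule Bochner_Integration.integrable_bound)
  show "integrable lebesgue (\<lambda>x. (norm (f x))\<^sup>2 + (norm (g x))\<^sup>2)"
    using assms by (auto dest: L2_integrable)
  show "(\<lambda>x. norm (f x) * norm (g x)) \<in> borel_measurable lebesgue"
    using assms[THEN L2_measurable] by measurable
  have "norm (norm (f x) * norm (g x)) \<le> norm ((norm (f x))\<^sup>2 + (norm (g x))\<^sup>2)" for x
  proof -
    have "0 \<le> norm (f x) * norm (g x)" by simp
    moreover have "2 * (norm (f x) * norm (g x)) \<le> (norm (f x))\<^sup>2 + (norm (g x))\<^sup>2"
      using sum_squares_bound[of "norm (f x)" "norm (g x)"] by (simp add: mult.assoc)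
    ultimately have "norm (f x) * norm (g x) \<le> (norm (f x))\<^sup>2 + (norm (g x))\<^sup>2"
      by linarith
    then show ?thesis by simp
  qed
  then show "AE x in lebesgue. norm (norm (f x) * norm (g x)) \<le> norm ((norm (f x))\<^sup>2 + (norm (g x))\<^sup>2)"
    by simp
qed

lemma L2_integrable_mult_cnj:
  assumes "f \<in> L2" "g \<in> L2"
  shows "integrable lebesgue (\<lambda>x. f x * cnj (g x))"
proof (rule Bochner_Integration.integrable_bound[OF L2_integrable_norm_mult[OF assms]])
  have [measurable]: "cnj \<in> borel_measurable borel"
    by (intro borel_measurable_continuous_onI continuous_intros)
  show "(\<lambda>x. f x * cnj (g x)) \<in> borel_measurable lebesgue"
    using assms[THEN L2_measurable] by measurable
qed (auto simp: norm_mult)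

text \<open>The squared form avoids square roots in all later estimates of sums of squared coefficients.\<close>

lemma L2_Cauchy_Schwarz:
  assumes "f \<in> L2" "g \<in> L2"
  shows "(norm (L2_inner f g))\<^sup>2 \<le> (L2_norm f)\<^sup>2 * (L2_norm g)\<^sup>2"
proof -
  have [measurable]: "f \<in> borel_measurable lebesgue" "g \<in> borel_measurable lebesgue"
    using assms[THEN L2_measurable] by auto
  define P where "P = (LINT x|lebesgue. norm (f x) * norm (g x))"
  have nn: "(\<integral>\<^sup>+x. ennreal (norm (f x)) * ennreal (norm (g x)) \<partial>lebesgue) = ennreal P"
    unfolding P_def using L2_integrable_norm_mult[OF assms]
    by (subst nn_integral_eq_integral[symmetric]) (auto simp: ennreal_mult)
  have sq: "(\<integral>\<^sup>+x. ennreal (norm (h x)) ^ 2 \<partial>lebesgue) = ennreal ((L2_norm h)\<^sup>2)" if "h \<in> L2" for h :: "real ^ 'a \<Rightarrow> complex"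
    unfolding L2_norm_square using L2_integrable[OF that]
    by (subst nn_integral_eq_integral[symmetric]) (auto simp: ennreal_power)
  have "ennreal P ^ 2 \<le> ennreal ((L2_norm f)\<^sup>2) * ennreal ((L2_norm g)\<^sup>2)"
    using Cauchy_Schwarz_nn_integral[of "\<lambda>x. ennreal (norm (f x))" lebesgue "\<lambda>x. ennreal (norm (g x))"]
    by (simp add: nn sq assms)
  moreover have "P \<ge> 0" by (simp add: P_def)
  ultimately have "P\<^sup>2 \<le> (L2_norm f)\<^sup>2 * (L2_norm g)\<^sup>2"
    by (simp add: ennreal_power flip: ennreal_mult)
  moreover have "norm (L2_inner f g) \<le> P"
    using integral_norm_bound[of lebesgue "\<lambda>x. f x * cnj (g x)"]
    by (simp add: L2_inner_def P_def norm_mult)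
  then have "(norm (L2_inner f g))\<^sup>2 \<le> P\<^sup>2" by (rule power_mono) simp
  ultimately show ?thesis by linarith
qed

lemma L2_inner_commute: "L2_inner g f = cnj (L2_inner f g)"
proof -
  have "(LINT x|lebesgue. cnj (f x * cnj (g x))) = cnj (LINT x|lebesgue. f x * cnj (g x))"
    by (rule Bochner_Integration.integral_cnj)
  then show ?thesis by (simp add: L2_inner_def mult.commute)
qed

lemma norm_L2_inner_commute: "norm (L2_inner g f) = norm (L2_inner f g)"
  by (subst L2_inner_commute) simp

lemma L2_inner_self: "L2_inner f f = of_real ((L2_norm f)\<^sup>2)"
  unfolding L2_inner_def L2_norm_square
  by (simp add: complex_norm_square[symmetric] flip: of_real_power integral_complex_of_real)

lemma L2_inner_add_left:
  assumes "f \<in> L2" "g \<in> L2" "h \<in> L2"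
  shows "L2_inner (\<lambda>x. f x + g x) h = L2_inner f h + L2_inner g h"
  unfolding L2_inner_def
  by (simp add: distrib_right Bochner_Integration.integral_add L2_integrable_mult_cnj assms)

lemma L2_restrict:
  assumes "f \<in> L2" "S \<in> sets lebesgue"
  shows "(\<lambda>x. indicator S x * f x) \<in> L2"
proof (rule L2_I)
  have [measurable]: "f \<in> borel_measurable lebesgue" "S \<in> sets lebesgue"
    using assms by (auto dest: L2_measurable)
  show "(\<lambda>x. indicator S x * f x) \<in> borel_measurable lebesgue" by measurable
  show "integrable lebesgue (\<lambda>x. (norm (indicator S x * f x))\<^sup>2)"
    by (rule Bochner_Integration.integrable_bound[OF L2_integrable[OF assms(1)]])
      (auto simp: indicator_def)
qed

lemma L2_norm_restrict:
  "(L2_norm (\<lambda>x. indicator S x * f x))\<^sup>2 = (LINT x:S|lebesgue. (norm (f x))\<^sup>2)"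
  unfolding L2_norm_square set_lebesgue_integral_def
  by (rule Bochner_Integration.integral_cong) (auto simp: indicator_def)

lemma L2_tail_tendsto_0:
  fixes f :: "real ^ 'a \<Rightarrow> complex"
  assumes "f \<in> L2"
  shows "(\<lambda>n. (L2_norm (\<lambda>x. indicator (- cball 0 (real n)) x * f x))\<^sup>2) \<longlonglongrightarrow> 0"
proof -
  have [measurable]: "f \<in> borel_measurable lebesgue"
    using assms by (auto dest: L2_measurable)
  have [measurable]: "- cball 0 (real n) \<in> sets (lebesgue :: (real ^ 'a) measure)" for n
    by simp
  have "(\<lambda>n. LINT x|lebesgue. (norm (indicator (- cball 0 (real n)) x * f x))\<^sup>2) \<longlonglongrightarrow> (LINT x|(lebesgue :: (real ^ 'a) measure). 0)"
  proof (rule integral_dominated_convergence[where w = "\<lambda>x. (norm (f x))\<^sup>2"])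
    show "AE x in lebesgue. (\<lambda>n. (norm (indicator (- cball 0 (real n)) x * f x))\<^sup>2) \<longlonglongrightarrow> 0"
    proof (intro AE_I2 tendsto_eventually)
      fix x :: "real ^ 'a"
      obtain N where "norm x \<le> real N" using real_arch_simple by blast
      then show "\<forall>\<^sub>F n in sequentially. (norm (indicator (- cball 0 (real n)) x * f x))\<^sup>2 = 0"
        by (intro eventually_sequentiallyI[of N]) (auto simp: indicator_def)
    qed
    show "\<And>n. (\<lambda>x. (norm (indicator (- cball 0 (real n)) x * f x))\<^sup>2) \<in> borel_measurable lebesgue"
      by measurable
  qed (use L2_integrable[OF assms] in \<open>auto simp: indicator_def\<close>)
  then show ?thesis by (simp add: L2_norm_square)
qed

text \<open>The factor \<open>\<bar>det U\<bar>\<^sup>1\<^sup>/\<^sup>2\<close> compensates the change of volume, which makes dilations with shift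
  unitary operators on \<open>L\<^sub>2\<close>.\<close>

lemma L2_dilate_shift:
  assumes "det U \<noteq> 0" "f \<in> L2"
  shows "dilate_shift U k f \<in> L2"
proof (rule L2_I)
  have [measurable]: "f \<in> borel_measurable lebesgue" "(\<lambda>x. U *v x - k) \<in> lebesgue \<rightarrow>\<^sub>M lebesgue"
    using assms measurable_matrix_affine by (auto dest: L2_measurable)
  show "dilate_shift U k f \<in> borel_measurable lebesgue"
    unfolding dilate_shift_def by measurable
  show "integrable lebesgue (\<lambda>x. (norm (dilate_shift U k f x))\<^sup>2)"
    using has_bochner_integral_matrix_affine[OF assms(1) has_bochner_integral_integrable[OF L2_integrable[OF assms(2)]], of k]
    by (auto simp: dilate_shift_def norm_mult power_mult_distrib has_bochner_integral_iff)
qed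

lemma L2_inner_dilate_shift:
  assumes "det U \<noteq> 0" "f \<in> L2" "g \<in> L2"
  shows "L2_inner (dilate_shift U k f) (dilate_shift U k g) = L2_inner f g"
proof -
  have "complex_of_real (sqrt \<bar>det U\<bar>) * complex_of_real (sqrt \<bar>det U\<bar>) = of_real \<bar>det U\<bar>"
    by (simp flip: of_real_mult)
  then have "dilate_shift U k f x * cnj (dilate_shift U k g x) = \<bar>det U\<bar> *\<^sub>R (f (U *v x - k) * cnj (g (U *v x - k)))" for x
    by (simp add: dilate_shift_def scaleR_conv_of_real)
  then show ?thesis
    using has_bochner_integral_matrix_affine[OF assms(1) has_bochner_integral_integrable[OF L2_integrable_mult_cnj[OF assms(2,3)]], of k]
    by (simp add: L2_inner_def has_bochner_integral_iff)
qed

lemma L2_norm_dilate_shift: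
  assumes "det U \<noteq> 0" "f \<in> L2"
  shows "(L2_norm (dilate_shift U k f))\<^sup>2 = (L2_norm f)\<^sup>2"
proof -
  have "complex_of_real ((L2_norm (dilate_shift U k f))\<^sup>2) = of_real ((L2_norm f)\<^sup>2)"
    using L2_inner_dilate_shift[OF assms(1) assms(2) assms(2)] by (simp only: L2_inner_self)
  then show ?thesis by (simp only: of_real_eq_iff)
qed

lemma dilate_shift_mult: "dilate_shift (A ** B) k f = dilate_shift B 0 (dilate_shift A k f)"
  by (auto simp: dilate_shift_def det_mul abs_mult real_sqrt_mult matrix_vector_mul_assoc)

lemma dilate_shift_mat_1 [simp]: "dilate_shift (mat 1) 0 f = f"
  by (simp add: dilate_shift_def)

context
  fixes M :: "real ^ 'd ^ 'd"
  assumes inv: "invertible M"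
begin

lemma matrix_powi_Suc: "matrix_powi M (j + 1) = M ** matrix_powi M j"
proof (cases "0 \<le> j")
  case True
  then have "nat (j + 1) = Suc (nat j)" by simp
  with True show ?thesis by (simp add: matrix_powi_def)
next
  case False
  define n where "n = nat (- j - 1)"
  have j: "nat (- j) = Suc n" "nat (- (j + 1)) = n" "nat (- j - 1) = n" using False by (auto simp: n_def)
  have "M ** matrix_powi M j = matrix_power (matrix_inv M) n"
    using False by (simp add: matrix_powi_def j matrix_mul_assoc matrix_inv_cancel[OF inv])
  also have "\<dots> = matrix_powi M (j + 1)"
  proof (cases "j = -1")
    case True
    then show ?thesis by (simp add: matrix_powi_def n_def)
  next
    case False
    with \<open>\<not> 0 \<le> j\<close> have "\<not> 0 \<le> j + 1" by simp
    then show ?thesis by (simp add: matrix_powi_def j)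
  qed
  finally show ?thesis by simp
qed

lemma matrix_powi_pred: "matrix_powi M (j - 1) = matrix_inv M ** matrix_powi M j"
  using matrix_powi_Suc[of "j - 1"] by (simp add: matrix_mul_assoc matrix_inv_cancel[OF inv])

lemma matrix_powi_add: "matrix_powi M (i + j) = matrix_powi M i ** matrix_powi M j"
proof (induction i rule: int_induct[where k = 0])
  case base
  then show ?case by (simp add: matrix_powi_def)
next
  case (step1 i)
  then show ?case
    using matrix_powi_Suc[of "i + j"] matrix_powi_Suc[of i] by (simp add: algebra_simps matrix_mul_assoc)
next
  case (step2 i)
  then show ?case
    using matrix_powi_pred[of "i + j"] matrix_powi_pred[of i] by (simp add: algebra_simps matrix_mul_assoc)
qed

lemma det_matrix_powi: "det (matrix_powi M j) \<noteq> 0"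
proof -
  have "matrix_powi M j ** matrix_powi M (- j) = mat 1"
    using matrix_powi_add[of j "- j"] by (simp add: matrix_powi_def[of M 0])
  then have "det (matrix_powi M j) * det (matrix_powi M (- j)) = 1"
    by (metis det_I det_mul)
  then show ?thesis by auto
qed

end

section \<open>Changing the coarsest level\<close>

text \<open>The frame constants are made explicit, because the passage to infinitely coarse levels needs them
  to be the same at every level.\<close>

definition frame_bounds :: "'i set \<Rightarrow> ('i \<Rightarrow> real ^ 'd \<Rightarrow> complex) \<Rightarrow> real \<Rightarrow> real \<Rightarrow> bool" where
  "frame_bounds I h C1 C2 \<longleftrightarrow>
     (\<forall>f\<in>L2.
        (\<lambda>i. (norm (L2_inner f (h i)))\<^sup>2) summable_on I \<and>
        C1 * (L2_norm f)\<^sup>2 \<le> (\<Sum>\<^sub>\<infinity>i\<in>I. (norm (L2_inner f (h i)))\<^sup>2) \<and>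
        (\<Sum>\<^sub>\<infinity>i\<in>I. (norm (L2_inner f (h i)))\<^sup>2) \<le> C2 * (L2_norm f)\<^sup>2)"

lemma L2_frame_iff_frame_bounds:
  "L2_frame I h \<longleftrightarrow> (\<forall>i\<in>I. h i \<in> L2) \<and> (\<exists>C1 C2. 0 < C1 \<and> 0 < C2 \<and> frame_bounds I h C1 C2)"
  by (simp add: L2_frame_def frame_bounds_def)

text \<open>The coefficients of \<open>f\<close> against the dilated family are those of the inversely dilated \<open>f\<close>, which has
  the same norm, against the original family.\<close>

lemma frame_bounds_dilate:
  fixes h :: "'i \<Rightarrow> real ^ 'd \<Rightarrow> complex" and h' :: "'j \<Rightarrow> real ^ 'd \<Rightarrow> complex"
  assumes fb: "frame_bounds I h C1 C2" and L2: "\<And>i. i \<in> I \<Longrightarrow> h i \<in> L2"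
    and UV: "V ** U = mat 1" and bij: "bij_betw \<tau> I I'"
    and h': "\<And>i. i \<in> I \<Longrightarrow> h' (\<tau> i) = dilate_shift U 0 (h i)"
  shows "frame_bounds I' h' C1 C2"
  unfolding frame_bounds_def
proof
  fix f :: "real ^ 'd \<Rightarrow> complex" assume f: "f \<in> L2"
  have "det V * det U = 1" using UV by (metis det_I det_mul)
  then have det: "det U \<noteq> 0" "det V \<noteq> 0" by auto
  define f' where "f' = dilate_shift V 0 f"
  have f': "f' \<in> L2" and norm: "(L2_norm f')\<^sup>2 = (L2_norm f)\<^sup>2"
    unfolding f'_def using det f by (simp_all add: L2_dilate_shift L2_norm_dilate_shift)
  have "f = dilate_shift U 0 f'"
    using UV by (simp add: f'_def flip: dilate_shift_mult)
  then have eq: "(norm (L2_inner f (h' (\<tau> i))))\<^sup>2 = (norm (L2_inner f' (h i)))\<^sup>2" if "i \<in> I" for i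
    using that h' L2 f' det by (simp add: L2_inner_dilate_shift)
  have "(\<lambda>i. (norm (L2_inner f (h' i)))\<^sup>2) summable_on I' \<longleftrightarrow> (\<lambda>i. (norm (L2_inner f' (h i)))\<^sup>2) summable_on I"
    using summable_on_reindex_bij_betw[OF bij] eq by (metis (mono_tags, lifting) summable_on_cong)
  moreover have "(\<Sum>\<^sub>\<infinity>i\<in>I'. (norm (L2_inner f (h' i)))\<^sup>2) = (\<Sum>\<^sub>\<infinity>i\<in>I. (norm (L2_inner f' (h i)))\<^sup>2)"
    using infsum_reindex_bij_betw[OF bij, of "\<lambda>i. (norm (L2_inner f (h' i)))\<^sup>2", symmetric] eq
    by (simp cong: infsum_cong)
  ultimately show "(\<lambda>i. (norm (L2_inner f (h' i)))\<^sup>2) summable_on I' \<and>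
        C1 * (L2_norm f)\<^sup>2 \<le> (\<Sum>\<^sub>\<infinity>i\<in>I'. (norm (L2_inner f (h' i)))\<^sup>2) \<and>
        (\<Sum>\<^sub>\<infinity>i\<in>I'. (norm (L2_inner f (h' i)))\<^sup>2) \<le> C2 * (L2_norm f)\<^sup>2"
    using bspec[OF fb[unfolded frame_bounds_def] f'] norm by simp
qed

text \<open>The effect of dilation by \<open>M\<^sup>n\<close> on the indices of a nonhomogeneous system: the scale of the wavelet
  part is raised by \<open>n\<close>. In the coarse part the scale is the parameter \<open>J\<close>, not part of the index.\<close>

definition scale_reindex :: "int \<Rightarrow> (nat \<times> (real ^ 'd)) + (int \<times> nat \<times> (real ^ 'd)) \<Rightarrow>
    (nat \<times> (real ^ 'd)) + (int \<times> nat \<times> (real ^ 'd))" where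
  "scale_reindex n = map_sum id (map_prod ((+) n) id)"

lemma bij_betw_scale_reindex:
  "bij_betw (scale_reindex n) (WS_nonhom_index J r s) (WS_nonhom_index (J + n) r s)"
proof (rule bij_betw_byWitness[where f' = "scale_reindex (- n)"])
  show "\<forall>a\<in>WS_nonhom_index J r s. scale_reindex (- n) (scale_reindex n a) = a"
    by (auto simp: WS_nonhom_index_def scale_reindex_def)
  show "\<forall>a\<in>WS_nonhom_index (J + n) r s. scale_reindex n (scale_reindex (- n) a) = a"
    by (auto simp: WS_nonhom_index_def scale_reindex_def)
  show "scale_reindex n ` WS_nonhom_index J r s \<subseteq> WS_nonhom_index (J + n) r s"
    by (auto simp: WS_nonhom_index_def scale_reindex_def)
  show "scale_reindex (- n) ` WS_nonhom_index (J + n) r s \<subseteq> WS_nonhom_index J r s"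
    by (auto simp: WS_nonhom_index_def scale_reindex_def)
qed

text \<open>In the argument \<open>M\<^sup>j (M\<^sup>n x) - k\<close> the shift comes after both dilations, so dilating by \<open>M\<^sup>n\<close>
  changes the scale of an element of the system and leaves its integer shift alone.\<close>

lemma dilate_matrix_powi_add:
  assumes "invertible M"
  shows "dilate_shift (matrix_powi M (j + n)) k f
       = dilate_shift (matrix_powi M n) 0 (dilate_shift (matrix_powi M j) k f)"
  by (simp add: matrix_powi_add assms dilate_shift_mult)

lemma WS_nonhom_scale_reindex:
  assumes "invertible M"
  shows "WS_nonhom M (J + n) \<phi> \<psi> (scale_reindex n i) = dilate_shift (matrix_powi M n) 0 (WS_nonhom M J \<phi> \<psi> i)"
proof (cases i)
  case (Inl a)
  then show ?thesis
    by (cases a) (simp add: WS_nonhom_def scale_reindex_def dilate_matrix_powi_add[OF assms])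
next
  case (Inr b)
  obtain j l k where "b = (j, l, k)" by (cases b)
  with Inr show ?thesis
    using dilate_matrix_powi_add[OF assms, of j n k "\<psi> l"]
    by (simp add: WS_nonhom_def WS_def scale_reindex_def add.commute)
qed

lemma WS_nonhom_L2:
  assumes "invertible M" and "\<forall>l\<in>gen_index r. \<phi> l \<in> L2" and "\<forall>l\<in>gen_index s. \<psi> l \<in> L2"
    and "i \<in> WS_nonhom_index J r s"
  shows "WS_nonhom M J \<phi> \<psi> i \<in> L2"
  using assms by (auto simp: WS_nonhom_def WS_def WS_nonhom_index_def intro!: L2_dilate_shift det_matrix_powi)

lemma frame_bounds_WS_nonhom_change_level:
  assumes M: "invertible M" and "\<forall>l\<in>gen_index r. \<phi> l \<in> L2" and "\<forall>l\<in>gen_index s. \<psi> l \<in> L2"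
    and "frame_bounds (WS_nonhom_index J r s) (WS_nonhom M J \<phi> \<psi>) C1 C2"
  shows "frame_bounds (WS_nonhom_index J' r s) (WS_nonhom M J' \<phi> \<psi>) C1 C2"
proof -
  have "frame_bounds (WS_nonhom_index (J + (J' - J)) r s) (WS_nonhom M (J + (J' - J)) \<phi> \<psi>) C1 C2"
  proof (rule frame_bounds_dilate[OF assms(4) WS_nonhom_L2 _ bij_betw_scale_reindex])
    show "matrix_powi M (J - J') ** matrix_powi M (J' - J) = mat 1"
      by (simp add: matrix_powi_def[of M 0] flip: matrix_powi_add[OF M])
    show "WS_nonhom M (J + (J' - J)) \<phi> \<psi> (scale_reindex (J' - J) i)
        = dilate_shift (matrix_powi M (J' - J)) 0 (WS_nonhom M J \<phi> \<psi> i)" for i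
      by (rule WS_nonhom_scale_reindex[OF M])
  qed (use assms in auto)
  then show ?thesis by simp
qed

lemma L2_frame_WS_nonhom_change_level:
  assumes M: "invertible M" and gen: "\<forall>l\<in>gen_index r. \<phi> l \<in> L2" "\<forall>l\<in>gen_index s. \<psi> l \<in> L2"
    and "L2_frame (WS_nonhom_index J r s) (WS_nonhom M J \<phi> \<psi>)"
  shows "L2_frame (WS_nonhom_index J' r s) (WS_nonhom M J' \<phi> \<psi>)"
  using assms(4) frame_bounds_WS_nonhom_change_level[OF M gen] WS_nonhom_L2[OF M gen]
  unfolding L2_frame_iff_frame_bounds by blast

lemma nonhom_dual_wavelet_frames_change_level:
  fixes M :: "real ^ 'd ^ 'd"
  assumes M: "invertible M"
    and phi: "\<forall>l\<in>gen_index r. \<phi> l \<in> L2" "\<forall>l\<in>gen_index r. \<phi>' l \<in> L2"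
    and psi: "\<forall>l\<in>gen_index s. \<psi> l \<in> L2" "\<forall>l\<in>gen_index s. \<psi>' l \<in> L2"
    and dual: "nonhom_dual_wavelet_frames M J r s \<phi> \<psi> \<phi>' \<psi>'"
  shows "nonhom_dual_wavelet_frames M J' r s \<phi> \<psi> \<phi>' \<psi>'"
  unfolding nonhom_dual_wavelet_frames_def
proof (intro conjI ballI)
  show "L2_frame (WS_nonhom_index J' r s) (WS_nonhom M J' \<phi> \<psi>)"
    by (rule L2_frame_WS_nonhom_change_level[where J = J, OF M phi(1) psi(1)])
      (use dual in \<open>simp add: nonhom_dual_wavelet_frames_def\<close>)
  show "L2_frame (WS_nonhom_index J' r s) (WS_nonhom M J' \<phi>' \<psi>')"
    by (rule L2_frame_WS_nonhom_change_level[where J = J, OF M phi(2) psi(2)])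
      (use dual in \<open>simp add: nonhom_dual_wavelet_frames_def\<close>)
  fix f g :: "real ^ 'd \<Rightarrow> complex" assume fg: "f \<in> L2" "g \<in> L2"
  define n where "n = J' - J"
  \<comment> \<open>Instead of moving the systems from level \<open>J\<close> to level \<open>J + n\<close>, the inverse dilation moves \<open>f\<close> and \<open>g\<close> back.\<close>
  let ?D = "dilate_shift (matrix_powi M n) 0" and ?E = "dilate_shift (matrix_powi M (- n)) 0"
  have det: "det (matrix_powi M j) \<noteq> 0" for j by (rule det_matrix_powi[OF M])
  have DE: "?D (?E f) = f" for f :: "real ^ 'd \<Rightarrow> complex"
    by (simp add: matrix_powi_def[of M 0] flip: dilate_shift_mult matrix_powi_add[OF M])
  have E: "?E f \<in> L2" "?E g \<in> L2" using fg by (auto intro!: L2_dilate_shift det)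
  have left: "L2_inner f (dilate_shift (matrix_powi M (j + n)) k h) = L2_inner (?E f) (dilate_shift (matrix_powi M j) k h)"
    if "h \<in> L2" for j k h
    using L2_inner_dilate_shift[OF det[of n] E(1), of "dilate_shift (matrix_powi M j) k h" 0] that det
    by (simp add: dilate_matrix_powi_add[OF M] DE L2_dilate_shift)
  have right: "L2_inner (dilate_shift (matrix_powi M (j + n)) k h) g = L2_inner (dilate_shift (matrix_powi M j) k h) (?E g)"
    if "h \<in> L2" for j k h
    using L2_inner_dilate_shift[OF det[of n] _ E(2), of "dilate_shift (matrix_powi M j) k h" 0] that det
    by (simp add: dilate_matrix_powi_add[OF M] DE L2_dilate_shift)
  have J': "J' = J + n" by (simp add: n_def)
  have bij: "bij_betw (\<lambda>j. j + n) {J..} {J'..}"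
    by (rule bij_betw_byWitness[where f' = "\<lambda>j. j - n"]) (auto simp: J')
  have "L2_inner f g = L2_inner (?E f) (?E g)"
    by (simp add: L2_inner_dilate_shift det fg)
  also have "\<dots> = (\<Sum>\<^sub>\<infinity>l\<in>gen_index r. \<Sum>\<^sub>\<infinity>k\<in>int_lattice.
           L2_inner (?E f) (dilate_shift (matrix_powi M J) k (\<phi> l)) *
           L2_inner (dilate_shift (matrix_powi M J) k (\<phi>' l)) (?E g)) +
        (\<Sum>\<^sub>\<infinity>j\<in>{J..}. \<Sum>\<^sub>\<infinity>l\<in>gen_index s. \<Sum>\<^sub>\<infinity>k\<in>int_lattice.
           L2_inner (?E f) (dilate_shift (matrix_powi M j) k (\<psi> l)) *
           L2_inner (dilate_shift (matrix_powi M j) k (\<psi>' l)) (?E g))"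
    using dual E unfolding nonhom_dual_wavelet_frames_def by blast
  also have "\<dots> = (\<Sum>\<^sub>\<infinity>l\<in>gen_index r. \<Sum>\<^sub>\<infinity>k\<in>int_lattice.
           L2_inner f (dilate_shift (matrix_powi M (J + n)) k (\<phi> l)) *
           L2_inner (dilate_shift (matrix_powi M (J + n)) k (\<phi>' l)) g) +
        (\<Sum>\<^sub>\<infinity>j\<in>{J..}. \<Sum>\<^sub>\<infinity>l\<in>gen_index s. \<Sum>\<^sub>\<infinity>k\<in>int_lattice.
           L2_inner f (dilate_shift (matrix_powi M (j + n)) k (\<psi> l)) *
           L2_inner (dilate_shift (matrix_powi M (j + n)) k (\<psi>' l)) g)"
    using phi psi by (simp add: left right cong: infsum_cong)
  finally show "L2_inner f g = (\<Sum>\<^sub>\<infinity>l\<in>gen_index r. \<Sum>\<^sub>\<infinity>k\<in>int_lattice.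
           L2_inner f (dilate_shift (matrix_powi M J') k (\<phi> l)) *
           L2_inner (dilate_shift (matrix_powi M J') k (\<phi>' l)) g) +
        (\<Sum>\<^sub>\<infinity>j\<in>{J'..}. \<Sum>\<^sub>\<infinity>l\<in>gen_index s. \<Sum>\<^sub>\<infinity>k\<in>int_lattice.
           L2_inner f (dilate_shift (matrix_powi M j) k (\<psi> l)) *
           L2_inner (dilate_shift (matrix_powi M j) k (\<psi>' l)) g)"
    by (simp add: J'[symmetric] infsum_reindex_bij_betw[OF bij, symmetric])
qed

section \<open>Square-summable families\<close>

lemma has_sum_finite_approx:
  assumes "(f has_sum s) A" and "e > 0"
  obtains F where "finite F" "F \<subseteq> A"
    "\<And>H. finite H \<Longrightarrow> F \<subseteq> H \<Longrightarrow> H \<subseteq> A \<Longrightarrow> dist (sum f H) s < e"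
proof -
  have "\<forall>\<^sub>F H in finite_subsets_at_top A. dist (sum f H) s < e"
    using assms by (simp add: has_sum_def tendsto_iff)
  then obtain X where "finite X" "X \<subseteq> A" "\<forall>Y. finite Y \<and> X \<subseteq> Y \<and> Y \<subseteq> A \<longrightarrow> dist (sum f Y) s < e"
    unfolding eventually_finite_subsets_at_top by blast
  then show thesis by (intro that[of X]) auto
qed

text \<open>Dominated convergence for sums (Tannery's theorem): outside a finite set all the sums are below a
  small tail of \<open>\<Sum> q\<close>, and on the finite set termwise limits may be taken.\<close>

lemma infsum_dominated_tendsto_0:
  fixes a :: "nat \<Rightarrow> 'i \<Rightarrow> real"
  assumes q: "q summable_on I"
    and bound: "\<And>n i. i \<in> I \<Longrightarrow> 0 \<le> a n i \<and> a n i \<le> q i"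
    and lim: "\<And>i. i \<in> I \<Longrightarrow> (\<lambda>n. a n i) \<longlonglongrightarrow> 0"
  shows "(\<lambda>n. infsum (a n) I) \<longlonglongrightarrow> 0"
proof (rule LIMSEQ_I)
  fix e :: real assume "e > 0"
  have a: "a n summable_on I" for n
    using q by (rule summable_on_comparison_test) (use bound in auto)
  obtain F where F: "finite F" "F \<subseteq> I"
      and F': "\<And>H. finite H \<Longrightarrow> F \<subseteq> H \<Longrightarrow> H \<subseteq> I \<Longrightarrow> dist (sum q H) (infsum q I) < e / 2"
    by (rule has_sum_finite_approx[OF has_sum_infsum[OF q] half_gt_zero[OF \<open>e > 0\<close>]]) blast
  have split: "infsum b I = sum b F + infsum b (I - F)" "b summable_on (I - F)" if "b summable_on I" for b :: "'i \<Rightarrow> real"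
  proof -
    show s: "b summable_on (I - F)" using that by (rule summable_on_subset_banach) auto
    have "infsum b (F \<union> (I - F)) = infsum b F + infsum b (I - F)"
      by (rule infsum_Un_disjoint) (use s F in auto)
    then show "infsum b I = sum b F + infsum b (I - F)"
      using F by (simp add: Un_absorb1)
  qed
  have "(\<lambda>n. sum (a n) F) \<longlonglongrightarrow> (\<Sum>i\<in>F. 0)"
    by (intro tendsto_sum lim) (use F in auto)
  then obtain N where N: "\<And>n. n \<ge> N \<Longrightarrow> sum (a n) F < e / 2"
    using LIMSEQ_D[of "\<lambda>n. sum (a n) F" 0 "e / 2"] \<open>e > 0\<close> by fastforce
  have "norm (infsum (a n) I - 0) < e" if "n \<ge> N" for n
  proof -
    have "infsum (a n) (I - F) \<le> infsum q (I - F)"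
      by (intro infsum_mono split q a) (use bound in auto)
    also have "\<dots> < e / 2" using F'[of F] F split(1)[OF q] by (simp add: dist_real_def)
    finally have "infsum (a n) I < e" using split(1)[OF a[of n]] N[OF that] by simp
    moreover have "0 \<le> infsum (a n) I" by (rule infsum_nonneg) (use bound in auto)
    ultimately show ?thesis by simp
  qed
  then show "\<exists>N. \<forall>n\<ge>N. norm (infsum (a n) I - 0) < e" by blast
qed

lemma infsum_atLeast_int_tendsto:
  fixes b :: "int \<Rightarrow> 'a::banach"
  assumes b: "b summable_on UNIV"
  shows "(\<lambda>n. infsum b {- int n..}) \<longlonglongrightarrow> infsum b UNIV"
proof (rule LIMSEQ_I)
  fix e :: real assume "e > 0"
  obtain F where F: "finite F" "\<And>H. finite H \<Longrightarrow> F \<subseteq> H \<Longrightarrow> dist (sum b H) (infsum b UNIV) < e / 2"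
    by (rule has_sum_finite_approx[OF has_sum_infsum[OF b] half_gt_zero[OF \<open>e > 0\<close>]]) simp
  obtain N where N: "F \<subseteq> {- int N..}"
  proof
    show "F \<subseteq> {- int (nat (- Min (insert 0 F)))..}"
    proof
      fix x assume "x \<in> F"
      then have "Min (insert 0 F) \<le> x" "Min (insert 0 F) \<le> 0"
        using F(1) by (auto intro!: Min_le simp del: Min_insert)
      then show "x \<in> {- int (nat (- Min (insert 0 F)))..}" by simp
    qed
  qed
  have "norm (infsum b {- int n..} - infsum b UNIV) < e" if "n \<ge> N" for n
  proof -
    have "b summable_on {- int n..}" using b by (rule summable_on_subset_banach) auto
    from has_sum_infsum[OF this] half_gt_zero[OF \<open>e > 0\<close>]
    obtain G where G: "finite G" "\<And>H. finite H \<Longrightarrow> G \<subseteq> H \<Longrightarrow> H \<subseteq> {- int n..} \<Longrightarrow> dist (sum b H) (infsum b {- int n..}) < e / 2"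
        "G \<subseteq> {- int n..}"
      by (rule has_sum_finite_approx) blast
    have "F \<subseteq> {- int n..}" using N that by auto
    then have "dist (sum b (F \<union> G)) (infsum b {- int n..}) < e / 2" using G F by auto
    moreover have "dist (sum b (F \<union> G)) (infsum b UNIV) < e / 2" using G F by auto
    ultimately have "dist (infsum b {- int n..}) (infsum b UNIV) < e / 2 + e / 2"
      using dist_triangle2[of "infsum b {- int n..}" "infsum b UNIV" "sum b (F \<union> G)"]
      by (simp add: dist_commute)
    then show ?thesis by (simp add: dist_norm)
  qed
  then show "\<exists>N. \<forall>n\<ge>N. norm (infsum b {- int n..} - infsum b UNIV) < e" by blast
qed

lemma square_summable_mult:
  fixes x y :: "'i \<Rightarrow> complex"
  assumes x: "(\<lambda>i. (norm (x i))\<^sup>2) summable_on A" and y: "(\<lambda>i. (norm (y i))\<^sup>2) summable_on A"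
  shows "(\<lambda>i. norm (x i * y i)) summable_on A"
  by (rule abs_summable_product) (use x y in \<open>simp_all add: norm_mult power2_eq_square\<close>)

text \<open>The Cauchy--Schwarz inequality for finite sums is passed to the limit.\<close>

lemma infsum_Cauchy_Schwarz:
  fixes x y :: "'i \<Rightarrow> complex"
  assumes x: "(\<lambda>i. (norm (x i))\<^sup>2) summable_on A" and y: "(\<lambda>i. (norm (y i))\<^sup>2) summable_on A"
  shows "(norm (\<Sum>\<^sub>\<infinity>i\<in>A. x i * y i))\<^sup>2 \<le> (\<Sum>\<^sub>\<infinity>i\<in>A. (norm (x i))\<^sup>2) * (\<Sum>\<^sub>\<infinity>i\<in>A. (norm (y i))\<^sup>2)"
proof -
  let ?X = "\<Sum>\<^sub>\<infinity>i\<in>A. (norm (x i))\<^sup>2" and ?Y = "\<Sum>\<^sub>\<infinity>i\<in>A. (norm (y i))\<^sup>2"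
  note abs = square_summable_mult[OF x y]
  have fin: "(\<Sum>i\<in>F. norm (x i * y i)) \<le> sqrt (?X * ?Y)" if F: "finite F" "F \<subseteq> A" for F
  proof -
    have "(\<Sum>i\<in>F. norm (x i * y i)) \<le> L2_set (\<lambda>i. norm (x i)) F * L2_set (\<lambda>i. norm (y i)) F"
      using L2_set_mult_ineq[of "\<lambda>i. norm (x i)" "\<lambda>i. norm (y i)" F] by (simp add: norm_mult)
    also have "\<dots> \<le> sqrt ?X * sqrt ?Y"
      unfolding L2_set_def
      by (intro mult_mono real_sqrt_le_mono finite_sum_le_infsum x y F) (auto intro!: sum_nonneg infsum_nonneg)
    finally show ?thesis by (simp add: real_sqrt_mult)
  qed
  have "norm (\<Sum>\<^sub>\<infinity>i\<in>A. x i * y i) \<le> (\<Sum>\<^sub>\<infinity>i\<in>A. norm (x i * y i))"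
    by (rule norm_infsum_bound[OF abs])
  also have "\<dots> \<le> sqrt (?X * ?Y)"
    by (rule infsum_le_finite_sums[OF abs fin])
  finally have "(norm (\<Sum>\<^sub>\<infinity>i\<in>A. x i * y i))\<^sup>2 \<le> (sqrt (?X * ?Y))\<^sup>2"
    by (rule power_mono) simp
  then show ?thesis by (simp add: infsum_nonneg)
qed

section \<open>Bessel families\<close>

definition bessel_bound :: "'i set \<Rightarrow> ('i \<Rightarrow> real ^ 'd \<Rightarrow> complex) \<Rightarrow> real \<Rightarrow> bool" where
  "bessel_bound I h C \<longleftrightarrow>
     (\<forall>f\<in>L2. (\<lambda>i. (norm (L2_inner f (h i)))\<^sup>2) summable_on I \<and>
        (\<Sum>\<^sub>\<infinity>i\<in>I. (norm (L2_inner f (h i)))\<^sup>2) \<le> C * (L2_norm f)\<^sup>2)"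

lemma bessel_bound_summable:
  "bessel_bound I h C \<Longrightarrow> f \<in> L2 \<Longrightarrow> (\<lambda>i. (norm (L2_inner f (h i)))\<^sup>2) summable_on I"
  and bessel_bound_le:
  "bessel_bound I h C \<Longrightarrow> f \<in> L2 \<Longrightarrow> (\<Sum>\<^sub>\<infinity>i\<in>I. (norm (L2_inner f (h i)))\<^sup>2) \<le> C * (L2_norm f)\<^sup>2"
  by (auto simp: bessel_bound_def)

lemma bessel_bound_summable_right:
  "bessel_bound I h C \<Longrightarrow> f \<in> L2 \<Longrightarrow> (\<lambda>i. (norm (L2_inner (h i) f))\<^sup>2) summable_on I"
  and bessel_bound_le_right:
  "bessel_bound I h C \<Longrightarrow> f \<in> L2 \<Longrightarrow> (\<Sum>\<^sub>\<infinity>i\<in>I. (norm (L2_inner (h i) f))\<^sup>2) \<le> C * (L2_norm f)\<^sup>2"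
  by (simp_all add: norm_L2_inner_commute[of _ f] bessel_bound_summable bessel_bound_le)

lemma frame_bounds_imp_bessel_bound: "frame_bounds I h C1 C2 \<Longrightarrow> bessel_bound I h C2"
  by (auto simp: frame_bounds_def bessel_bound_def)

lemma bessel_bound_reindex:
  assumes h: "bessel_bound I h C" and inj: "inj_on \<tau> A" and sub: "\<tau> ` A \<subseteq> I"
  shows "bessel_bound A (\<lambda>a. h (\<tau> a)) C"
  unfolding bessel_bound_def
proof
  fix f :: "real ^ 'b \<Rightarrow> complex" assume f: "f \<in> L2"
  let ?q = "\<lambda>i. (norm (L2_inner f (h i)))\<^sup>2"
  note s = bessel_bound_summable[OF h f]
  have s': "?q summable_on \<tau> ` A" using s sub by (rule summable_on_subset_banach)
  have "infsum ?q (\<tau> ` A) \<le> infsum ?q I"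
    by (rule infsum_mono_neutral[OF s' s]) (use sub in auto)
  also note bessel_bound_le[OF h f]
  finally show "(\<lambda>a. ?q (\<tau> a)) summable_on A \<and> (\<Sum>\<^sub>\<infinity>a\<in>A. ?q (\<tau> a)) \<le> C * (L2_norm f)\<^sup>2"
    using s' by (simp add: summable_on_reindex[OF inj] infsum_reindex[OF inj] o_def)
qed

text \<open>A Bessel inequality is a statement about finite partial sums, so it is enough that every finite
  part of the family lies in a subfamily with the given bound.\<close>

lemma bessel_bound_directed:
  assumes "\<And>F. finite F \<Longrightarrow> F \<subseteq> I \<Longrightarrow> \<exists>A. F \<subseteq> A \<and> bessel_bound A h C"
  shows "bessel_bound I h C"
  unfolding bessel_bound_def
proof
  fix f :: "real ^ 'b \<Rightarrow> complex" assume f: "f \<in> L2"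
  let ?q = "\<lambda>i. (norm (L2_inner f (h i)))\<^sup>2"
  have fin: "sum ?q F \<le> C * (L2_norm f)\<^sup>2" if F: "finite F" "F \<subseteq> I" for F
  proof -
    obtain A where A: "F \<subseteq> A" "bessel_bound A h C" using assms[OF F] by blast
    have "sum ?q F \<le> infsum ?q A"
      by (rule finite_sum_le_infsum[OF bessel_bound_summable[OF A(2) f]]) (use F A in auto)
    also note bessel_bound_le[OF A(2) f]
    finally show ?thesis .
  qed
  have "?q summable_on I"
    by (rule nonneg_bdd_above_summable_on) (auto intro!: bdd_aboveI2 fin)
  then show "?q summable_on I \<and> infsum ?q I \<le> C * (L2_norm f)\<^sup>2"
    using infsum_le_finite_sums fin by blast
qed

text \<open>By Cauchy--Schwarz, \<open>\<parallel>f\<parallel>\<^sup>4 \<le> \<Sum>\<bar>\<langle>f, h\<^sub>i\<rangle>\<bar>\<^sup>2 \<Sum>\<bar>\<langle>h'\<^sub>i, f\<rangle>\<bar>\<^sup>2 \<le> \<Sum>\<bar>\<langle>f, h\<^sub>i\<rangle>\<bar>\<^sup>2 C' \<parallel>f\<parallel>\<^sup>2\<close>,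
  and one factor \<open>\<parallel>f\<parallel>\<^sup>2\<close> cancels.\<close>

lemma dual_bessel_imp_lower_bound:
  assumes b: "bessel_bound I h C" "bessel_bound I h' C'" and C: "0 < C'" and f: "f \<in> L2"
    and dual: "L2_inner f f = (\<Sum>\<^sub>\<infinity>i\<in>I. L2_inner f (h i) * L2_inner (h' i) f)"
  shows "(1 / C') * (L2_norm f)\<^sup>2 \<le> (\<Sum>\<^sub>\<infinity>i\<in>I. (norm (L2_inner f (h i)))\<^sup>2)"
proof (cases "L2_norm f = 0")
  case False
  then have pos: "0 < (L2_norm f)\<^sup>2" by simp
  let ?S = "\<Sum>\<^sub>\<infinity>i\<in>I. (norm (L2_inner f (h i)))\<^sup>2"
  have "((L2_norm f)\<^sup>2)\<^sup>2 = (norm (L2_inner f f))\<^sup>2" by (simp add: L2_inner_self norm_power)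
  also have "\<dots> \<le> ?S * (\<Sum>\<^sub>\<infinity>i\<in>I. (norm (L2_inner (h' i) f))\<^sup>2)"
    unfolding dual by (rule infsum_Cauchy_Schwarz) (use b f bessel_bound_summable bessel_bound_summable_right in blast)+
  also have "\<dots> \<le> ?S * (C' * (L2_norm f)\<^sup>2)"
    by (intro mult_left_mono bessel_bound_le_right[OF b(2) f] infsum_nonneg) simp
  finally have "(L2_norm f)\<^sup>2 * (L2_norm f)\<^sup>2 \<le> (?S * C') * (L2_norm f)\<^sup>2"
    by (simp add: power2_eq_square mult_ac)
  then have "(L2_norm f)\<^sup>2 \<le> ?S * C'" by (rule mult_right_le_imp_le) (rule pos)
  then show ?thesis using C by (simp add: field_simps)
qed (auto intro: infsum_nonneg)

lemma dual_bessel_imp_frame: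
  assumes L2: "\<And>i. i \<in> I \<Longrightarrow> h i \<in> L2"
    and b: "bessel_bound I h C" "bessel_bound I h' C'" and C: "0 < C" "0 < C'"
    and dual: "\<And>f. f \<in> L2 \<Longrightarrow> L2_inner f f = (\<Sum>\<^sub>\<infinity>i\<in>I. L2_inner f (h i) * L2_inner (h' i) f)"
  shows "L2_frame I h"
  unfolding L2_frame_iff_frame_bounds
proof (intro conjI ballI exI)
  show "frame_bounds I h (1 / C') C"
    using dual_bessel_imp_lower_bound[OF b C(2) _ dual] b(1)
    unfolding frame_bounds_def bessel_bound_def by blast
qed (use L2 C in auto)

section \<open>Mass near the integer lattice\<close>

lemma int_lattice_dist_ge_1:
  fixes k k' :: "real ^ 'd"
  assumes "k \<in> int_lattice" "k' \<in> int_lattice" "k \<noteq> k'"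
  shows "1 \<le> dist k k'"
proof -
  obtain i where i: "k $ i \<noteq> k' $ i" using assms(3) by (auto simp: vec_eq_iff)
  have "k $ i - k' $ i \<in> \<int>" using assms by (auto simp: int_lattice_def)
  then have "1 \<le> \<bar>k $ i - k' $ i\<bar>" using i by (intro Ints_nonzero_abs_ge1) auto
  also have "\<dots> \<le> dist k k'" using component_le_norm_cart[of "k - k'" i] by (simp add: dist_norm)
  finally show ?thesis .
qed

lemma L2_set_integrable:
  assumes "\<phi> \<in> L2" "S \<in> sets lebesgue"
  shows "set_integrable lebesgue S (\<lambda>x. (norm (\<phi> x))\<^sup>2)"
  unfolding set_integrable_def
  by (rule integrable_mult_indicator[OF assms(2) L2_integrable[OF assms(1)]])

lemma L2_set_integral_nonneg: "0 \<le> (LINT x:S|lebesgue. (norm (\<phi> x))\<^sup>2)"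
  unfolding set_lebesgue_integral_def by (rule Bochner_Integration.integral_nonneg) auto

text \<open>Distinct lattice points have distance at least one, so the balls are disjoint and the sum is the
  integral over their union.\<close>

lemma sum_lattice_balls_le:
  assumes \<phi>: "\<phi> \<in> L2" and F: "finite F" "F \<subseteq> int_lattice" and \<delta>: "\<delta> \<le> 1 / 2"
  shows "(\<Sum>k\<in>F. LINT y:ball (- k) \<delta>|lebesgue. (norm (\<phi> y))\<^sup>2) \<le> (L2_norm \<phi>)\<^sup>2"
proof -
  have disj: "disjoint_family_on (\<lambda>k. ball (- k) \<delta>) F"
    unfolding disjoint_family_on_def
  proof (intro ballI impI)
    fix k k' assume "k \<in> F" "k' \<in> F" "k \<noteq> k'"
    then have "1 \<le> dist k k'" using F int_lattice_dist_ge_1 by blast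
    then have "1 \<le> dist (- k) (- k')" by (simp add: dist_minus)
    then show "ball (- k) \<delta> \<inter> ball (- k') \<delta> = {}" using \<delta> by (intro disjoint_ballI) simp
  qed
  have int: "integrable lebesgue (\<lambda>y. indicator (ball (- k) \<delta>) y *\<^sub>R (norm (\<phi> y))\<^sup>2)" for k
    using L2_set_integrable[OF \<phi>, of "ball (- k) \<delta>"] by (simp add: set_integrable_def)
  have "(\<Sum>k\<in>F. LINT y:ball (- k) \<delta>|lebesgue. (norm (\<phi> y))\<^sup>2)
      = (LINT y|lebesgue. (\<Sum>k\<in>F. indicator (ball (- k) \<delta>) y *\<^sub>R (norm (\<phi> y))\<^sup>2))"
    unfolding set_lebesgue_integral_def by (subst Bochner_Integration.integral_sum) (use int in auto)
  also have "\<dots> \<le> (LINT y|lebesgue. (norm (\<phi> y))\<^sup>2)"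
  proof (rule integral_mono)
    fix y
    have "(\<Sum>k\<in>F. indicator (ball (- k) \<delta>) y *\<^sub>R (norm (\<phi> y))\<^sup>2)
        = indicator (\<Union>k\<in>F. ball (- k) \<delta>) y * (norm (\<phi> y))\<^sup>2"
      by (simp add: indicator_UN_disjoint[OF F(1) disj] sum_distrib_right)
    also have "\<dots> \<le> (norm (\<phi> y))\<^sup>2" by (auto simp: indicator_def)
    finally show "(\<Sum>k\<in>F. indicator (ball (- k) \<delta>) y *\<^sub>R (norm (\<phi> y))\<^sup>2) \<le> (norm (\<phi> y))\<^sup>2" .
  qed (use int L2_integrable[OF \<phi>] in auto)
  finally show ?thesis by (simp add: L2_norm_square)
qed

text \<open>The balls shrink to a single point, which is a null set. The radii \<open>1 / (m + 2)\<close> are at most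
  \<open>1 / 2\<close>, as the disjointness of balls around lattice points requires.\<close>

lemma L2_shrinking_ball_tendsto_0:
  assumes \<phi>: "\<phi> \<in> L2"
  shows "(\<lambda>m. LINT y:ball a (1 / (real m + 2))|lebesgue. (norm (\<phi> y))\<^sup>2) \<longlonglongrightarrow> 0"
proof -
  have [measurable]: "\<phi> \<in> borel_measurable lebesgue" using \<phi> by (rule L2_measurable)
  have "(\<lambda>m. LINT y|lebesgue. indicator (ball a (1 / (real m + 2))) y *\<^sub>R (norm (\<phi> y))\<^sup>2)
     \<longlonglongrightarrow> (LINT y|lebesgue. indicator {a} y *\<^sub>R (norm (\<phi> y))\<^sup>2)"
  proof (rule integral_dominated_convergence[where w = "\<lambda>y. (norm (\<phi> y))\<^sup>2"])
    show "AE y in lebesgue. (\<lambda>m. indicator (ball a (1 / (real m + 2))) y *\<^sub>R (norm (\<phi> y))\<^sup>2)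
        \<longlonglongrightarrow> indicator {a} y *\<^sub>R (norm (\<phi> y))\<^sup>2"
    proof (intro AE_I2 tendsto_eventually)
      fix y
      show "\<forall>\<^sub>F m in sequentially. indicator (ball a (1 / (real m + 2))) y *\<^sub>R (norm (\<phi> y))\<^sup>2
          = indicator {a} y *\<^sub>R (norm (\<phi> y))\<^sup>2"
      proof (cases "y = a")
        case False
        have "(\<lambda>m. 1 / (real m + 2)) \<longlonglongrightarrow> 0" by real_asymp
        then have "\<forall>\<^sub>F m in sequentially. 1 / (real m + 2) < dist a y"
          using False by (intro order_tendstoD(2)) auto
        then show ?thesis by eventually_elim (use False in \<open>auto simp: indicator_def\<close>)
      qed simp
    qed
    show "(\<lambda>y. indicator {a} y *\<^sub>R (norm (\<phi> y))\<^sup>2) \<in> borel_measurable lebesgue"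
      using L2_set_integrable[OF \<phi>, of "{a}"] by (simp add: set_integrable_def)
    show "(\<lambda>y. indicator (ball a (1 / (real m + 2))) y *\<^sub>R (norm (\<phi> y))\<^sup>2) \<in> borel_measurable lebesgue" for m
      using L2_set_integrable[OF \<phi>, of "ball a (1 / (real m + 2))"] by (simp add: set_integrable_def)
  qed (use L2_integrable[OF \<phi>] in \<open>auto simp: indicator_def\<close>)
  moreover have "(LINT y|lebesgue. indicator {a} y *\<^sub>R (norm (\<phi> y))\<^sup>2) = 0"
  proof (rule integral_eq_zero_AE)
    have "{a} \<in> null_sets lebesgue"
      by (intro null_sets_completionI finite_imp_null_set_lborel) simp
    then have "AE y in lebesgue. y \<notin> {a}" by (rule AE_not_in)
    then show "AE y in lebesgue. indicator {a} y *\<^sub>R (norm (\<phi> y))\<^sup>2 = 0" by eventually_elim simp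
  qed
  ultimately show ?thesis by (simp add: set_lebesgue_integral_def)
qed

text \<open>If \<open>U\<close> maps the support of \<open>f\<close> into a small ball around \<open>0\<close>, then on this support the shifted
  dilate of \<open>\<phi>\<close> only takes values that \<open>\<phi>\<close> attains near \<open>-k\<close>, and \<open>\<phi>\<close> may be replaced by its
  restriction before Cauchy--Schwarz is applied.\<close>

lemma L2_inner_dilate_shift_localized:
  assumes f: "f \<in> L2" and supp: "\<And>x. R < norm x \<Longrightarrow> f x = 0"
    and \<phi>: "\<phi> \<in> L2" and det: "det U \<noteq> 0" and shrink: "\<And>x. norm x \<le> R \<Longrightarrow> norm (U *v x) < \<delta>"
  shows "(norm (L2_inner f (dilate_shift U k \<phi>)))\<^sup>2
    \<le> (L2_norm f)\<^sup>2 * (LINT y:ball (- k) \<delta>|lebesgue. (norm (\<phi> y))\<^sup>2)"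
proof -
  define h where "h = dilate_shift U k (\<lambda>y. indicator (ball (- k) \<delta>) y * \<phi> y)"
  have L2: "(\<lambda>y. indicator (ball (- k) \<delta>) y * \<phi> y) \<in> L2"
    using L2_restrict[OF \<phi>, of "ball (- k) \<delta>"] by simp
  have "f x * cnj (dilate_shift U k \<phi> x) = f x * cnj (h x)" for x
  proof (cases "norm x \<le> R")
    case True
    then have "norm (U *v x) < \<delta>" by (rule shrink)
    then have "U *v x - k \<in> ball (- k) \<delta>" by (simp add: dist_norm norm_minus_commute)
    then show ?thesis by (simp add: h_def dilate_shift_def)
  qed (simp add: supp)
  then have "L2_inner f (dilate_shift U k \<phi>) = L2_inner f h"
    by (simp only: L2_inner_def)
  then show ?thesis
    using L2_Cauchy_Schwarz[OF f L2_dilate_shift[OF det L2, of k]]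
    by (simp add: h_def[symmetric]) (simp add: h_def L2_norm_dilate_shift[OF det L2] L2_norm_restrict)
qed

lemma lattice_ball_integrals_summable:
  fixes \<phi> :: "nat \<Rightarrow> real ^ 'd \<Rightarrow> complex"
  assumes L2: "\<forall>l\<in>G. \<phi> l \<in> L2" and sum: "(\<lambda>l. (L2_norm (\<phi> l))\<^sup>2) summable_on G" and \<delta>: "\<delta> \<le> 1 / 2"
  shows "(\<lambda>(l, k). LINT y:ball (- k) \<delta>|lebesgue. (norm (\<phi> l y))\<^sup>2) summable_on G \<times> int_lattice"
    (is "?q summable_on _")
proof (rule nonneg_bdd_above_summable_on)
  show "bdd_above (sum ?q ` {F. F \<subseteq> G \<times> int_lattice \<and> finite F})"
  proof (rule bdd_aboveI2)
    fix F assume "F \<in> {F. F \<subseteq> G \<times> (int_lattice :: (real ^ 'd) set) \<and> finite F}"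
    then have F: "finite F" "F \<subseteq> G \<times> int_lattice" by auto
    have "sum ?q F \<le> sum ?q (fst ` F \<times> snd ` F)"
      by (rule sum_mono2) (use F in \<open>auto simp: rev_image_eqI L2_set_integral_nonneg\<close>)
    also have "\<dots> = (\<Sum>l\<in>fst ` F. \<Sum>k\<in>snd ` F. ?q (l, k))"
      by (simp add: sum.cartesian_product)
    also have "\<dots> \<le> (\<Sum>l\<in>fst ` F. (L2_norm (\<phi> l))\<^sup>2)"
    proof (rule sum_mono)
      fix l assume "l \<in> fst ` F"
      then have "\<phi> l \<in> L2" using F L2 by auto
      moreover have "snd ` F \<subseteq> int_lattice" using F by auto
      ultimately show "(\<Sum>k\<in>snd ` F. ?q (l, k)) \<le> (L2_norm (\<phi> l))\<^sup>2"
        using F(1) \<delta> sum_lattice_balls_le[of "\<phi> l" "snd ` F"] by auto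
    qed
    also have "\<dots> \<le> (\<Sum>\<^sub>\<infinity>l\<in>G. (L2_norm (\<phi> l))\<^sup>2)"
      by (rule finite_sum_le_infsum[OF sum]) (use F in auto)
    finally show "sum ?q F \<le> (\<Sum>\<^sub>\<infinity>l\<in>G. (L2_norm (\<phi> l))\<^sup>2)" .
  qed
qed (auto simp: L2_set_integral_nonneg)

text \<open>The total mass of the generators near the lattice vanishes as the radius shrinks. The integrals over
  the balls of radius \<open>1 / 2\<close> are a summable majorant; this is where \<open>\<Sum>\<parallel>\<phi>\<^sup>l\<parallel>\<^sup>2 < \<infinity>\<close> enters.\<close>

lemma lattice_ball_sums_tendsto_0:
  fixes \<phi> :: "nat \<Rightarrow> real ^ 'd \<Rightarrow> complex"
  assumes L2: "\<forall>l\<in>G. \<phi> l \<in> L2" and sum: "(\<lambda>l. (L2_norm (\<phi> l))\<^sup>2) summable_on G"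
  shows "(\<lambda>m. \<Sum>\<^sub>\<infinity>(l, k)\<in>G \<times> int_lattice. LINT y:ball (- k) (1 / (real m + 2))|lebesgue. (norm (\<phi> l y))\<^sup>2)
     \<longlonglongrightarrow> 0"
proof (rule infsum_dominated_tendsto_0)
  let ?q = "\<lambda>(l, k). LINT y:ball (- k) (1 / 2)|lebesgue. (norm (\<phi> l y))\<^sup>2"
  show "?q summable_on G \<times> int_lattice"
    by (rule lattice_ball_integrals_summable[OF L2 sum]) simp
  fix p assume p: "p \<in> G \<times> (int_lattice :: (real ^ 'd) set)"
  obtain l k where lk: "p = (l, k)" by (cases p)
  with p L2 have \<phi>: "\<phi> l \<in> L2" by auto
  show "(\<lambda>m. case p of (l, k) \<Rightarrow> LINT y:ball (- k) (1 / (real m + 2))|lebesgue. (norm (\<phi> l y))\<^sup>2) \<longlonglongrightarrow> 0"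
    using L2_shrinking_ball_tendsto_0[OF \<phi>] by (simp add: lk)
  fix m
  have "(LINT y:ball (- k) (1 / (real m + 2))|lebesgue. (norm (\<phi> l y))\<^sup>2) \<le> ?q (l, k)"
  proof -
    have "ball (- k) (1 / (real m + 2)) \<subseteq> ball (- k) (1/2)"
      by (rule subset_ball) (simp add: field_simps)
    then show ?thesis
      unfolding set_lebesgue_integral_def prod.case
      by (intro integral_mono L2_set_integrable[OF \<phi>, unfolded set_integrable_def])
        (auto simp: indicator_def)
  qed
  then show "0 \<le> (case p of (l, k) \<Rightarrow> LINT y:ball (- k) (1 / (real m + 2))|lebesgue. (norm (\<phi> l y))\<^sup>2) \<and>
      (case p of (l, k) \<Rightarrow> LINT y:ball (- k) (1 / (real m + 2))|lebesgue. (norm (\<phi> l y))\<^sup>2) \<le> ?q p"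
    by (simp add: lk L2_set_integral_nonneg)
qed

section \<open>Letting the coarsest level tend to minus infinity\<close>

text \<open>The coarse part of a nonhomogeneous system. It is the part that has to disappear in the limit, so it
  is separated from the wavelet part and gets its own index set.\<close>

definition level_system :: "real ^ 'd ^ 'd \<Rightarrow> int \<Rightarrow> (nat \<Rightarrow> real ^ 'd \<Rightarrow> complex) \<Rightarrow>
    nat \<times> (real ^ 'd) \<Rightarrow> real ^ 'd \<Rightarrow> complex" where
  "level_system M J \<phi> = (\<lambda>(l, k). dilate_shift (matrix_powi M J) k (\<phi> l))"

lemma bessel_bound_coarse_level:
  assumes "frame_bounds (WS_nonhom_index J r s) (WS_nonhom M J \<phi> \<psi>) C1 C2"
  shows "bessel_bound (gen_index r \<times> int_lattice) (level_system M J \<phi>) C2"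
proof -
  have "bessel_bound (gen_index r \<times> int_lattice) (\<lambda>p. WS_nonhom M J \<phi> \<psi> (Inl p)) C2"
    by (rule bessel_bound_reindex[OF frame_bounds_imp_bessel_bound[OF assms]])
      (auto simp: WS_nonhom_index_def)
  then show ?thesis by (simp add: WS_nonhom_def level_system_def)
qed

text \<open>A finite part of the homogeneous system involves only finitely many scales, so it lies in
  every nonhomogeneous system of sufficiently low level.\<close>

lemma bessel_bound_WS:
  assumes "\<And>J. frame_bounds (WS_nonhom_index J r s) (WS_nonhom M J \<phi> \<psi>) C1 C2"
  shows "bessel_bound (WS_index s) (WS M \<psi>) C2"
proof (rule bessel_bound_directed)
  fix F :: "(int \<times> nat \<times> (real ^ 'a)) set" assume F: "finite F" "F \<subseteq> WS_index s"
  define J where "J = Min (insert 0 (fst ` F))"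
  have "J \<le> j" if "(j, p) \<in> F" for j p
  proof -
    have "j \<in> fst ` F" using that by (force simp: image_iff)
    then show ?thesis unfolding J_def using F(1) by (intro Min_le) auto
  qed
  then have "F \<subseteq> {J..} \<times> gen_index s \<times> int_lattice"
    using F(2) by (fastforce simp: WS_index_def)
  moreover have "bessel_bound ({J..} \<times> gen_index s \<times> int_lattice) (\<lambda>p. WS_nonhom M J \<phi> \<psi> (Inr p)) C2"
    by (rule bessel_bound_reindex[OF frame_bounds_imp_bessel_bound[OF assms]])
      (auto simp: WS_nonhom_index_def)
  then have "bessel_bound ({J..} \<times> gen_index s \<times> int_lattice) (WS M \<psi>) C2"
    by (simp add: WS_nonhom_def)
  ultimately show "\<exists>A. F \<subseteq> A \<and> bessel_bound A (WS M \<psi>) C2" by blast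
qed

text \<open>The part \<open>f2\<close> of \<open>f\<close> far from the origin is handled by the Bessel bound, uniformly in the level. For
  the part \<open>f1\<close> on a ball, \<open>M\<^sup>-\<^sup>n\<close> maps that ball into a ball of small radius, so its coefficients are
  controlled by the mass of the generators near the lattice.\<close>

lemma coarse_level_tendsto_0:
  fixes M :: "real ^ 'd ^ 'd"
  assumes M: "invertible M" "expansive M"
    and \<phi>: "\<forall>l\<in>gen_index r. \<phi> l \<in> L2" and sum: "(\<lambda>l. (L2_norm (\<phi> l))\<^sup>2) summable_on gen_index r"
    and bessel: "\<And>J. bessel_bound (gen_index r \<times> int_lattice) (level_system M J \<phi>) C"
    and f: "f \<in> L2"
  shows "(\<lambda>n. \<Sum>\<^sub>\<infinity>p\<in>gen_index r \<times> int_lattice. (norm (L2_inner f (level_system M (- int n) \<phi> p)))\<^sup>2) \<longlonglongrightarrow> 0"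
proof (rule LIMSEQ_I)
  fix e :: real assume e: "e > 0"
  let ?I = "gen_index r \<times> (int_lattice :: (real ^ 'd) set)"
  let ?T = "\<lambda>n f. \<Sum>\<^sub>\<infinity>p\<in>?I. (norm (L2_inner f (level_system M (- int n) \<phi> p)))\<^sup>2"
  let ?Q = "\<lambda>m. \<Sum>\<^sub>\<infinity>(l, k)\<in>?I. LINT y:ball (- k) (1 / (real m + 2))|lebesgue. (norm (\<phi> l y))\<^sup>2"
  have "(\<lambda>R. C * (L2_norm (\<lambda>x. indicator (- cball 0 (real R)) x * f x))\<^sup>2) \<longlonglongrightarrow> C * 0"
    by (intro tendsto_intros L2_tail_tendsto_0 f)
  \<comment> \<open>quarters of \<open>e\<close>, because \<open>\<bar>a + b\<bar>\<^sup>2 \<le> 2 \<bar>a\<bar>\<^sup>2 + 2 \<bar>b\<bar>\<^sup>2\<close> doubles both parts below\<close>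
  then obtain R :: nat where R: "C * (L2_norm (\<lambda>x. indicator (- cball 0 (real R)) x * f x))\<^sup>2 < e / 4"
    using order_tendstoD(2)[of _ "C * 0" sequentially "e / 4"] e by (auto simp: eventually_sequentially)
  define f1 where "f1 = (\<lambda>x. indicator (cball 0 (real R)) x * f x)"
  define f2 where "f2 = (\<lambda>x. indicator (- cball 0 (real R)) x * f x)"
  have f12: "f1 \<in> L2" "f2 \<in> L2"
    unfolding f1_def f2_def by (auto intro!: L2_restrict f)
  have f_eq: "f = (\<lambda>x. f1 x + f2 x)" by (auto simp: f1_def f2_def indicator_def)
  have "(\<lambda>m. (L2_norm f1)\<^sup>2 * ?Q m) \<longlonglongrightarrow> (L2_norm f1)\<^sup>2 * 0"
    by (intro tendsto_intros lattice_ball_sums_tendsto_0[OF \<phi> sum])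
  then obtain m :: nat where m: "(L2_norm f1)\<^sup>2 * ?Q m < e / 4"
    using order_tendstoD(2)[of _ "(L2_norm f1)\<^sup>2 * 0" sequentially "e / 4"] e by (auto simp: eventually_sequentially)
  obtain N where N: "\<And>n x. n \<ge> N \<Longrightarrow> norm x \<le> real R \<Longrightarrow> norm (matrix_power (matrix_inv M) n *v x) < 1 / (real m + 2)"
    using expansive_inv_power_shrinks_balls[OF M, of "1 / (real m + 2)" "real R"] by (auto simp: eventually_sequentially)
  have "norm (?T n f - 0) < e" if n: "n \<ge> N" for n
  proof -
    have powi: "matrix_powi M (- int n) = matrix_power (matrix_inv M) n"
      by (cases "n = 0") (auto simp: matrix_powi_def)
    have bound: "(norm (L2_inner f1 (level_system M (- int n) \<phi> (l, k))))\<^sup>2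
        \<le> (L2_norm f1)\<^sup>2 * (LINT y:ball (- k) (1 / (real m + 2))|lebesgue. (norm (\<phi> l y))\<^sup>2)"
      if "l \<in> gen_index r" for l k
      unfolding level_system_def prod.case
    proof (rule L2_inner_dilate_shift_localized[OF f12(1)])
      show "f1 x = 0" if "real R < norm x" for x using that by (simp add: f1_def)
      show "norm (matrix_powi M (- int n) *v x) < 1 / (real m + 2)" if "norm x \<le> real R" for x
        using N[OF n that] by (simp add: powi)
    qed (use \<phi> that det_matrix_powi[OF M(1)] in auto)
    note s = bessel_bound_summable[OF bessel, of _ "- int n"]
    have "?T n f1 \<le> (\<Sum>\<^sub>\<infinity>(l, k)\<in>?I. (L2_norm f1)\<^sup>2 * (LINT y:ball (- k) (1 / (real m + 2))|lebesgue. (norm (\<phi> l y))\<^sup>2))"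
    proof (rule infsum_mono[OF s[OF f12(1)]])
      show "(\<lambda>(l, k). (L2_norm f1)\<^sup>2 * (LINT y:ball (- k) (1 / (real m + 2))|lebesgue. (norm (\<phi> l y))\<^sup>2)) summable_on ?I"
        using summable_on_cmult_right[OF lattice_ball_integrals_summable[OF \<phi> sum, of "1 / (real m + 2)"], of "(L2_norm f1)\<^sup>2"]
        by (simp add: case_prod_unfold field_simps)
    qed (use bound in auto)
    also have "\<dots> = (L2_norm f1)\<^sup>2 * ?Q m"
      by (simp add: case_prod_unfold infsum_cmult_right')
    finally have T1: "?T n f1 < e / 4" using m by linarith
    have T2: "?T n f2 < e / 4"
      using bessel_bound_le[OF bessel f12(2), of "- int n"] R by (simp add: f2_def)
    have "?T n f \<le> (\<Sum>\<^sub>\<infinity>p\<in>?I. 2 * (norm (L2_inner f1 (level_system M (- int n) \<phi> p)))\<^sup>2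
        + 2 * (norm (L2_inner f2 (level_system M (- int n) \<phi> p)))\<^sup>2)"
    proof (rule infsum_mono[OF s[OF f]])
      show "(\<lambda>p. 2 * (norm (L2_inner f1 (level_system M (- int n) \<phi> p)))\<^sup>2
        + 2 * (norm (L2_inner f2 (level_system M (- int n) \<phi> p)))\<^sup>2) summable_on ?I"
        by (intro summable_on_add summable_on_cmult_right s f12)
      fix p assume "p \<in> ?I"
      then have L2: "level_system M (- int n) \<phi> p \<in> L2"
        using \<phi> det_matrix_powi[OF M(1)] by (auto simp: level_system_def intro!: L2_dilate_shift)
      let ?a = "L2_inner f1 (level_system M (- int n) \<phi> p)" and ?b = "L2_inner f2 (level_system M (- int n) \<phi> p)"
      have "L2_inner f (level_system M (- int n) \<phi> p) = ?a + ?b"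
        by (subst f_eq) (rule L2_inner_add_left[OF f12 L2])
      then have "(norm (L2_inner f (level_system M (- int n) \<phi> p)))\<^sup>2 \<le> (norm ?a + norm ?b)\<^sup>2"
        by (simp add: norm_triangle_ineq power_mono)
      also have "\<dots> \<le> 2 * (norm ?a)\<^sup>2 + 2 * (norm ?b)\<^sup>2"
        using sum_squares_bound[of "norm ?a" "norm ?b"] by (simp add: power2_sum)
      finally show "(norm (L2_inner f (level_system M (- int n) \<phi> p)))\<^sup>2 \<le> 2 * (norm ?a)\<^sup>2 + 2 * (norm ?b)\<^sup>2" .
    qed
    also have "\<dots> = 2 * ?T n f1 + 2 * ?T n f2"
      by (simp add: infsum_add infsum_cmult_right' summable_on_cmult_right s f12)
    finally have "?T n f < e" using T1 T2 by linarith
    moreover have "0 \<le> ?T n f" by (rule infsum_nonneg) simp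
    ultimately show ?thesis by simp
  qed
  then show "\<exists>N. \<forall>n\<ge>N. norm (?T n f - 0) < e" by blast
qed

text \<open>The constants \<open>C\<close> and \<open>C'\<close> do not depend on the level \<open>J\<close>; the limit \<open>J \<rightarrow> -\<infinity>\<close> relies on
  this uniformity.\<close>

context
  fixes M :: "real ^ 'd ^ 'd" and r s :: enat and \<phi> \<psi> \<phi>' \<psi>' :: "nat \<Rightarrow> real ^ 'd \<Rightarrow> complex" and C C' :: real
  assumes M: "invertible M" "expansive M"
    and \<phi>: "\<forall>l\<in>gen_index r. \<phi> l \<in> L2" and sum: "(\<lambda>l. (L2_norm (\<phi> l))\<^sup>2) summable_on gen_index r"
    and b: "bessel_bound (WS_index s) (WS M \<psi>) C" "bessel_bound (WS_index s) (WS M \<psi>') C'"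
    and bl: "\<And>J. bessel_bound (gen_index r \<times> int_lattice) (level_system M J \<phi>) C"
      "\<And>J. bessel_bound (gen_index r \<times> int_lattice) (level_system M J \<phi>') C'"
    and dual: "\<And>J. nonhom_dual_wavelet_frames M J r s \<phi> \<psi> \<phi>' \<psi>'"
begin

text \<open>Cauchy--Schwarz separates the two generator families. The square sum of the coefficients
  against \<open>\<phi>\<close> tends to zero, and that of the coefficients against \<open>\<phi>'\<close> is bounded by the Bessel
  constant.\<close>

lemma coarse_sum_tendsto_0:
  assumes f: "f \<in> L2" and g: "g \<in> L2"
  shows "(\<lambda>n. \<Sum>\<^sub>\<infinity>l\<in>gen_index r. \<Sum>\<^sub>\<infinity>k\<in>int_lattice.
     L2_inner f (dilate_shift (matrix_powi M (- int n)) k (\<phi> l)) *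
     L2_inner (dilate_shift (matrix_powi M (- int n)) k (\<phi>' l)) g) \<longlonglongrightarrow> 0"
proof -
  let ?I = "gen_index r \<times> (int_lattice :: (real ^ 'd) set)"
  let ?x = "\<lambda>n p. L2_inner f (level_system M (- int n) \<phi> p)"
  let ?y = "\<lambda>n p. L2_inner (level_system M (- int n) \<phi>' p) g"
  have x: "(\<lambda>p. (norm (?x n p))\<^sup>2) summable_on ?I" and y: "(\<lambda>p. (norm (?y n p))\<^sup>2) summable_on ?I" for n
    using bl f g bessel_bound_summable bessel_bound_summable_right by blast+
  have "(\<Sum>\<^sub>\<infinity>l\<in>gen_index r. \<Sum>\<^sub>\<infinity>k\<in>int_lattice.
       L2_inner f (dilate_shift (matrix_powi M (- int n)) k (\<phi> l)) *
       L2_inner (dilate_shift (matrix_powi M (- int n)) k (\<phi>' l)) g) = (\<Sum>\<^sub>\<infinity>p\<in>?I. ?x n p * ?y n p)" for n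
    using infsum_Sigma_banach[OF abs_summable_summable[OF square_summable_mult[OF x y]], of n]
    by (simp add: level_system_def)
  moreover have "(\<lambda>n. \<Sum>\<^sub>\<infinity>p\<in>?I. ?x n p * ?y n p) \<longlonglongrightarrow> 0"
  proof -
    have "(\<lambda>n. (\<Sum>\<^sub>\<infinity>p\<in>?I. (norm (?x n p))\<^sup>2) * (C' * (L2_norm g)\<^sup>2)) \<longlonglongrightarrow> 0 * (C' * (L2_norm g)\<^sup>2)"
      by (intro tendsto_intros coarse_level_tendsto_0[OF M \<phi> sum bl(1) f])
    then have lim: "(\<lambda>n. (\<Sum>\<^sub>\<infinity>p\<in>?I. (norm (?x n p))\<^sup>2) * (C' * (L2_norm g)\<^sup>2)) \<longlonglongrightarrow> 0" by simp
    have "(norm (\<Sum>\<^sub>\<infinity>p\<in>?I. ?x n p * ?y n p))\<^sup>2 \<le> (\<Sum>\<^sub>\<infinity>p\<in>?I. (norm (?x n p))\<^sup>2) * (C' * (L2_norm g)\<^sup>2)" for n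
      using infsum_Cauchy_Schwarz[OF x[of n] y[of n]]
        mult_left_mono[OF bessel_bound_le_right[OF bl(2)[of "- int n"] g], of "\<Sum>\<^sub>\<infinity>p\<in>?I. (norm (?x n p))\<^sup>2"]
      by (auto simp: infsum_nonneg)
    then have "(\<lambda>n. (norm (\<Sum>\<^sub>\<infinity>p\<in>?I. ?x n p * ?y n p))\<^sup>2) \<longlonglongrightarrow> 0"
      by (intro tendsto_sandwich[OF _ _ tendsto_const lim]) auto
    then have "(\<lambda>n. sqrt ((norm (\<Sum>\<^sub>\<infinity>p\<in>?I. ?x n p * ?y n p))\<^sup>2)) \<longlonglongrightarrow> sqrt 0"
      by (rule tendsto_real_sqrt)
    then show ?thesis by (simp add: tendsto_norm_zero_iff)
  qed
  ultimately show ?thesis by simp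
qed

text \<open>The wavelet part of the reconstruction formula of level \<open>-n\<close> is a sum over the scales \<open>j \<ge> -n\<close> of
  an absolutely summable family, and its coarse part tends to zero. The second form, a single sum over
  the index set, is the one that matches the Bessel inequalities.\<close>

lemma WS_reconstruction:
  assumes f: "f \<in> L2" and g: "g \<in> L2"
  shows "L2_inner f g = (\<Sum>\<^sub>\<infinity>j\<in>UNIV. \<Sum>\<^sub>\<infinity>l\<in>gen_index s. \<Sum>\<^sub>\<infinity>k\<in>int_lattice.
           L2_inner f (dilate_shift (matrix_powi M j) k (\<psi> l)) *
           L2_inner (dilate_shift (matrix_powi M j) k (\<psi>' l)) g)" (is "_ = infsum ?b UNIV")
    and "L2_inner f g = (\<Sum>\<^sub>\<infinity>i\<in>WS_index s. L2_inner f (WS M \<psi> i) * L2_inner (WS M \<psi>' i) g)" (is "_ = infsum ?c _")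
proof -
  let ?P = "gen_index s \<times> (int_lattice :: (real ^ 'd) set)"
  have "(\<lambda>i. norm (?c i)) summable_on WS_index s"
    by (rule square_summable_mult) (use b f g bessel_bound_summable bessel_bound_summable_right in blast)+
  then have c: "?c summable_on UNIV \<times> ?P"
    by (simp add: abs_summable_summable WS_index_def)
  have c': "(\<lambda>(j, p). ?c (j, p)) summable_on UNIV \<times> ?P"
  proof -
    have "(\<lambda>(j, p). ?c (j, p)) = ?c" by (simp add: fun_eq_iff)
    with c show ?thesis by simp
  qed
  have cj: "(\<lambda>p. ?c (j, p)) summable_on ?P" for j
    by (rule summable_on_SigmaD1[OF c']) simp
  have b_eq: "?b j = (\<Sum>\<^sub>\<infinity>p\<in>?P. ?c (j, p))" for j
    using infsum_Sigma_banach[OF cj[of j]] by (simp add: WS_def)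
  have b: "?b summable_on UNIV" and bc: "infsum ?b UNIV = infsum ?c (WS_index s)"
    using summable_on_Sigma_banach[OF c'] infsum_Sigma_banach[OF c]
    by (simp_all add: b_eq WS_index_def)
  have "(\<lambda>n. (\<Sum>\<^sub>\<infinity>l\<in>gen_index r. \<Sum>\<^sub>\<infinity>k\<in>int_lattice.
       L2_inner f (dilate_shift (matrix_powi M (- int n)) k (\<phi> l)) *
       L2_inner (dilate_shift (matrix_powi M (- int n)) k (\<phi>' l)) g) + infsum ?b {- int n..})
      \<longlonglongrightarrow> 0 + infsum ?b UNIV"
    by (intro tendsto_add coarse_sum_tendsto_0[OF f g] infsum_atLeast_int_tendsto[OF b])
  moreover have "L2_inner f g = (\<Sum>\<^sub>\<infinity>l\<in>gen_index r. \<Sum>\<^sub>\<infinity>k\<in>int_lattice.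
       L2_inner f (dilate_shift (matrix_powi M (- int n)) k (\<phi> l)) *
       L2_inner (dilate_shift (matrix_powi M (- int n)) k (\<phi>' l)) g) + infsum ?b {- int n..}" for n
    using dual[of "- int n"] f g unfolding nonhom_dual_wavelet_frames_def by blast
  ultimately have "(\<lambda>n. L2_inner f g) \<longlonglongrightarrow> infsum ?b UNIV" by simp
  then show "L2_inner f g = infsum ?b UNIV" by (rule LIMSEQ_unique[OF tendsto_const])
  with bc show "L2_inner f g = infsum ?c (WS_index s)" by simp
qed

end

theorem proposition5:
  fixes M :: "real ^ 'd ^ 'd"
    and r s :: enat
    and \<phi> \<psi> \<phi>' \<psi>' :: "nat \<Rightarrow> real ^ 'd \<Rightarrow> complex"
  assumes "invertible M"
    and "\<forall>l\<in>gen_index r. \<phi> l \<in> L2 \<and> \<phi>' l \<in> L2"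
    and "\<forall>l\<in>gen_index s. \<psi> l \<in> L2 \<and> \<psi>' l \<in> L2"
    and "\<exists>J::int. nonhom_dual_wavelet_frames M J r s \<phi> \<psi> \<phi>' \<psi>'"
  shows "(\<forall>J::int. nonhom_dual_wavelet_frames M J r s \<phi> \<psi> \<phi>' \<psi>') \<and>
         (expansive M \<and> (\<lambda>l. (L2_norm (\<phi> l))\<^sup>2) summable_on gen_index r \<longrightarrow>
            hom_dual_wavelet_frames M s \<psi> \<psi>')"
proof (intro conjI impI)
  note M = \<open>invertible M\<close>
  have \<phi>: "\<forall>l\<in>gen_index r. \<phi> l \<in> L2" "\<forall>l\<in>gen_index r. \<phi>' l \<in> L2"
    and \<psi>: "\<forall>l\<in>gen_index s. \<psi> l \<in> L2" "\<forall>l\<in>gen_index s. \<psi>' l \<in> L2"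
    using assms(2,3) by auto
  obtain J0 where J0: "nonhom_dual_wavelet_frames M J0 r s \<phi> \<psi> \<phi>' \<psi>'"
    using assms(4) by blast
  then have dual: "nonhom_dual_wavelet_frames M J r s \<phi> \<psi> \<phi>' \<psi>'" for J
    by (rule nonhom_dual_wavelet_frames_change_level[OF M \<phi> \<psi>])
  then show "\<forall>J. nonhom_dual_wavelet_frames M J r s \<phi> \<psi> \<phi>' \<psi>'" by blast
  assume "expansive M \<and> (\<lambda>l. (L2_norm (\<phi> l))\<^sup>2) summable_on gen_index r"
  then have exp: "expansive M" and sum: "(\<lambda>l. (L2_norm (\<phi> l))\<^sup>2) summable_on gen_index r" by auto
  obtain c C where C: "0 < C" "frame_bounds (WS_nonhom_index J0 r s) (WS_nonhom M J0 \<phi> \<psi>) c C"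
    using J0 by (auto simp: nonhom_dual_wavelet_frames_def L2_frame_iff_frame_bounds)
  obtain c' C' where C': "0 < C'" "frame_bounds (WS_nonhom_index J0 r s) (WS_nonhom M J0 \<phi>' \<psi>') c' C'"
    using J0 by (auto simp: nonhom_dual_wavelet_frames_def L2_frame_iff_frame_bounds)
  note fb = frame_bounds_WS_nonhom_change_level[OF M \<phi>(1) \<psi>(1) C(2)]
    frame_bounds_WS_nonhom_change_level[OF M \<phi>(2) \<psi>(2) C'(2)]
  note b = bessel_bound_WS[OF fb(1)] bessel_bound_WS[OF fb(2)]
  note rec = WS_reconstruction[OF M exp \<phi>(1) sum b
      bessel_bound_coarse_level[OF fb(1)] bessel_bound_coarse_level[OF fb(2)] dual]
  have L2: "WS M \<psi> i \<in> L2" "WS M \<psi>' i \<in> L2" if "i \<in> WS_index s" for i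
    using that \<psi> by (auto simp: WS_def WS_index_def intro!: L2_dilate_shift det_matrix_powi[OF M])
  \<comment> \<open>The roles of the two systems in the formula for \<open>\<langle>f, f\<rangle>\<close> are exchanged by conjugation.\<close>
  have swap: "L2_inner f f = (\<Sum>\<^sub>\<infinity>i\<in>WS_index s. L2_inner f (WS M \<psi>' i) * L2_inner (WS M \<psi> i) f)"
    if f: "f \<in> L2" for f
  proof -
    have "L2_inner f f = cnj (L2_inner f f)" by (rule L2_inner_commute)
    also have "\<dots> = cnj (\<Sum>\<^sub>\<infinity>i\<in>WS_index s. L2_inner f (WS M \<psi> i) * L2_inner (WS M \<psi>' i) f)"
      by (simp only: rec(2)[OF f f])
    also have "\<dots> = (\<Sum>\<^sub>\<infinity>i\<in>WS_index s. cnj (L2_inner f (WS M \<psi> i) * L2_inner (WS M \<psi>' i) f))"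
      by (simp only: infsum_cnj)
    also have "\<dots> = (\<Sum>\<^sub>\<infinity>i\<in>WS_index s. L2_inner f (WS M \<psi>' i) * L2_inner (WS M \<psi> i) f)"
      by (simp add: L2_inner_commute[of f, symmetric] L2_inner_commute[of _ f, symmetric] mult.commute)
    finally show ?thesis .
  qed
  have "L2_frame (WS_index s) (WS M \<psi>)"
    by (rule dual_bessel_imp_frame[OF L2(1) b C(1) C'(1) rec(2)])
  moreover have "L2_frame (WS_index s) (WS M \<psi>')"
    by (rule dual_bessel_imp_frame[OF L2(2) b(2,1) C'(1) C(1) swap])
  ultimately show "hom_dual_wavelet_frames M s \<psi> \<psi>'"
    using rec(1) by (auto simp: hom_dual_wavelet_frames_def)
qed

end
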